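(* Let $s\in[0,1]$, and let $S_h$, $V_h$, $\nabla_h$, $A_h$, $\Lambda_h$ and $\beta$ be as defined in the context. Then for every $u\in S_h$ $$\beta^{2(1-s)}(A_h^s u,u)\le (\Lambda_h^{-(1-s)}\nabla_h u,\nabla_h u)\le (A_h^s u,u).$$
   Context: $\Omega\subset\mathbb{R}^n$ is a bounded polygonal domain, $(\cdot,\cdot)$ and $\|\cdot\|$ are the $L^2(\Omega)$ inner product and norm (for scalar or vector fields), and $\mathcal{T}_h$ is a shape-regular triangulation of $\Omega$ with characteristic mesh size $h$. Fix an integer $r\ge 0$. $S_h=\{u\in L^2(\Omega): u|_T\in P_r(T)\ \forall T\in\mathcal{T}_h\}$ is the space of discontinuous piecewise polynomials of degree at most $r$, and $V_h=\mathcal{RT}_r(\mathcal{T}_h)\subset H(\mathrm{div};\Omega)$ is the Raviart-Thomas space of index $r$ (no boundary conditions), so $\mathrm{div}(V_h)\subset S_h$. The discrete gradient $\nabla_h:S_h\to V_h$ is defined by $(\nabla_h u,\tau)=-(u,\mathrm{div}\,\tau)$ for $u\in S_h$, $\tau\in V_h$. The discrete Laplacian $A_h:S_h\to S_h$ is $A_h=\nabla_h^*\nabla_h$, i.e. $(A_hu,v)=(\nabla_hu,\nabla_hv)$. $\Lambda_h:V_h\to V_h$ is defined by $(\Lambda_h\sigma,\tau)=(\sigma,\tau)+(\mathrm{div}\,\sigma,\mathrm{div}\,\tau)$. $\beta>0$ is a constant independent of $h$ (its existence is well known) such that for every $u\in S_h$ $$\sup_{0\ne\tau\in V_h}\frac{(u,\mathrm{div}\,\tau)}{(\Lambda_h\tau,\tau)^{1/2}}\ge\beta\|u\|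 .$$ In particular $\nabla_h$ is injective and $A_h$ is symmetric positive definite. Adjoints and fractional powers are with respect to the $L^2$ inner product; fractional powers of symmetric positive definite operators are defined by the spectral decomposition. *)

theory Defs
  imports "HOL-Analysis.Analysis"
begin

section \<open>The space $L^2$\<close>

definition square_integrable :: "('a::euclidean_space \<Rightarrow> 'b::euclidean_space) \<Rightarrow> bool" where
  "square_integrable f \<longleftrightarrow>
     f \<in> borel_measurable lebesgue \<and> integrable lebesgue (\<lambda>x. (norm (f x))\<^sup>2)"

lemma square_integrable_0: "square_integrable (\<lambda>x. 0)"
  by (simp add: square_integrable_def)

lemma square_integrable_add:
  assumes "square_integrable f" "square_integrable g"
  shows "square_integrable (\<lambda>x. f x + g x)"
proof -
  have m: "f \<in> borel_measurable lebesgue" "g \<in> borel_measurable lebesgue"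
    and i: "integrable lebesgue (\<lambda>x. (norm (f x))\<^sup>2)" "integrable lebesgue (\<lambda>x. (norm (g x))\<^sup>2)"
    using assms by (auto simp: square_integrable_def)
  have ms: "(\<lambda>x. f x + g x) \<in> borel_measurable lebesgue"
    using m by (intro borel_measurable_add)
  have "(norm (f x + g x))\<^sup>2 \<le> 2 * (norm (f x))\<^sup>2 + 2 * (norm (g x))\<^sup>2" for x
  proof -
    have "(norm (f x + g x))\<^sup>2 \<le> (norm (f x) + norm (g x))\<^sup>2"
      by (simp add: norm_triangle_ineq power_mono)
    also have "\<dots> \<le> 2 * (norm (f x))\<^sup>2 + 2 * (norm (g x))\<^sup>2"
      using zero_le_power2[of "norm (f x) - norm (g x)"]
      by (simp add: power2_sum power2_diff)
    finally show ?thesis .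
  qed
  then have le: "AE x in lebesgue. norm ((norm (f x + g x))\<^sup>2)
      \<le> norm (2 * (norm (f x))\<^sup>2 + 2 * (norm (g x))\<^sup>2)"
    by simp
  have "integrable lebesgue (\<lambda>x. 2 * (norm (f x))\<^sup>2 + 2 * (norm (g x))\<^sup>2)"
    by (intro Bochner_Integration.integrable_add integrable_mult_right i)
  moreover have "(\<lambda>x. (norm (f x + g x))\<^sup>2) \<in> borel_measurable lebesgue"
    using ms by measurable
  ultimately have "integrable lebesgue (\<lambda>x. (norm (f x + g x))\<^sup>2)"
    using le by (rule Bochner_Integration.integrable_bound)
  then show ?thesis
    using ms by (simp add: square_integrable_def)
qed

lemma square_integrable_scaleR:
  "square_integrable f \<Longrightarrow> square_integrable (\<lambda>x. c *\<^sub>R f x)"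
  by (simp add: square_integrable_def power_mult_distrib borel_measurable_scaleR)

lemma square_integrable_inner:
  assumes "square_integrable f" "square_integrable g"
  shows "integrable lebesgue (\<lambda>x. f x \<bullet> g x)"
proof -
  have m: "f \<in> borel_measurable lebesgue" "g \<in> borel_measurable lebesgue"
    and i: "integrable lebesgue (\<lambda>x. (norm (f x))\<^sup>2)" "integrable lebesgue (\<lambda>x. (norm (g x))\<^sup>2)"
    using assms by (auto simp: square_integrable_def)
  have "\<bar>f x \<bullet> g x\<bar> \<le> (norm (f x))\<^sup>2 + (norm (g x))\<^sup>2" for x
  proof -
    have "\<bar>f x \<bullet> g x\<bar> \<le> norm (f x) * norm (g x)"
      by (rule Cauchy_Schwarz_ineq2)
    moreover have "0 \<le> norm (f x) * norm (g x)"
      by simp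
    moreover have "0 \<le> (norm (f x) - norm (g x))\<^sup>2"
      by simp
    ultimately show ?thesis
      unfolding power2_diff by linarith
  qed
  then have "AE x in lebesgue. norm (f x \<bullet> g x) \<le> norm ((norm (f x))\<^sup>2 + (norm (g x))\<^sup>2)"
    by simp
  with Bochner_Integration.integrable_add[OF i] borel_measurable_inner[OF m]
  show ?thesis
    by (rule Bochner_Integration.integrable_bound)
qed

definition L2_rel :: "('a::euclidean_space \<Rightarrow> 'b::euclidean_space) \<Rightarrow> ('a \<Rightarrow> 'b) \<Rightarrow> bool" where
  "L2_rel f g \<longleftrightarrow> square_integrable f \<and> square_integrable g \<and> (AE x in lebesgue. f x = g x)"

text \<open>Square-integrable functions on all of the Euclidean space, modulo equality almost everywhere.\<close>

quotient_type (overloaded) ('a, 'b) L2 =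
  "'a::euclidean_space \<Rightarrow> 'b::euclidean_space" / partial: L2_rel
proof (rule part_equivpI)
  show "\<exists>f. L2_rel f f"
    using square_integrable_0 by (auto simp: L2_rel_def)
  show "symp L2_rel"
    by (auto simp: symp_def L2_rel_def elim: AE_mp)
  show "transp L2_rel"
    by (auto simp: transp_def L2_rel_def elim: AE_mp)
qed

instantiation L2 :: (euclidean_space, euclidean_space) real_vector
begin

lift_definition zero_L2 :: "('a, 'b) L2" is "\<lambda>x. 0"
  by (simp add: L2_rel_def square_integrable_0)

lift_definition plus_L2 :: "('a, 'b) L2 \<Rightarrow> ('a, 'b) L2 \<Rightarrow> ('a, 'b) L2" is "\<lambda>f g x. f x + g x"
  by (auto simp: L2_rel_def square_integrable_add elim: AE_mp)

lift_definition scaleR_L2 :: "real \<Rightarrow> ('a, 'b) L2 \<Rightarrow> ('a, 'b) L2" is "\<lambda>c f x. c *\<^sub>R f x"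
  by (auto simp: L2_rel_def square_integrable_scaleR elim: AE_mp)

definition uminus_L2 :: "('a, 'b) L2 \<Rightarrow> ('a, 'b) L2" where
  "uminus_L2 f = (- 1) *\<^sub>R f"

definition minus_L2 :: "('a, 'b) L2 \<Rightarrow> ('a, 'b) L2 \<Rightarrow> ('a, 'b) L2" where
  "minus_L2 f g = f + (- g)"

instance
proof
  fix f g h :: "('a, 'b) L2" and a b :: real
  show "f + g + h = f + (g + h)"
    by transfer (auto simp: L2_rel_def square_integrable_add add.assoc)
  show "f + g = g + f"
    by transfer (auto simp: L2_rel_def square_integrable_add add.commute)
  show "0 + f = f"
    by transfer (auto simp: L2_rel_def)
  show "- f + f = 0"
    unfolding uminus_L2_def by transfer (auto simp: L2_rel_def square_integrable_0)
  show "f - g = f + - g"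
    by (simp add: minus_L2_def)
  show "a *\<^sub>R (f + g) = a *\<^sub>R f + a *\<^sub>R g"
    by transfer
      (auto simp: L2_rel_def scaleR_add_right square_integrable_add square_integrable_scaleR)
  show "(a + b) *\<^sub>R f = a *\<^sub>R f + b *\<^sub>R f"
    by transfer
      (simp add: L2_rel_def scaleR_add_left square_integrable_add square_integrable_scaleR)
  show "a *\<^sub>R b *\<^sub>R f = (a * b) *\<^sub>R f"
    by transfer (auto simp: L2_rel_def square_integrable_scaleR)
  show "1 *\<^sub>R f = f"
    by transfer (auto simp: L2_rel_def)
qed

end

instantiation L2 :: (euclidean_space, euclidean_space) real_inner
begin

lift_definition inner_L2 :: "('a, 'b) L2 \<Rightarrow> ('a, 'b) L2 \<Rightarrow> real" is
  "\<lambda>f g. LINT x|lebesgue. f x \<bullet> g x"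
  by (intro integral_cong_AE)
     (auto simp: L2_rel_def square_integrable_def intro!: borel_measurable_inner elim: AE_mp)

definition norm_L2 :: "('a, 'b) L2 \<Rightarrow> real" where
  "norm_L2 f = sqrt (f \<bullet> f)"

definition sgn_L2 :: "('a, 'b) L2 \<Rightarrow> ('a, 'b) L2" where
  "sgn_L2 f = f /\<^sub>R norm f"

definition dist_L2 :: "('a, 'b) L2 \<Rightarrow> ('a, 'b) L2 \<Rightarrow> real" where
  "dist_L2 f g = norm (f - g)"

definition uniformity_L2 :: "(('a, 'b) L2 \<times> ('a, 'b) L2) filter" where
  "uniformity_L2 = (INF e\<in>{0<..}. principal {(x, y). dist x y < e})"

definition open_L2 :: "('a, 'b) L2 set \<Rightarrow> bool" where
  "open_L2 U \<longleftrightarrow> (\<forall>x\<in>U. eventually (\<lambda>(x', y). x' = x \<longrightarrow> y \<in> U) uniformity)"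

instance
proof
  fix f g h :: "('a, 'b) L2" and a :: real and U :: "('a, 'b) L2 set"
  show "dist f g = norm (f - g)"
    by (simp add: dist_L2_def)
  show "sgn f = f /\<^sub>R norm f"
    by (simp add: sgn_L2_def)
  show "(uniformity :: (('a, 'b) L2 \<times> ('a, 'b) L2) filter)
      = (INF e\<in>{0<..}. principal {(x, y). dist x y < e})"
    by (simp add: uniformity_L2_def)
  show "open U \<longleftrightarrow> (\<forall>x\<in>U. eventually (\<lambda>(x', y). x' = x \<longrightarrow> y \<in> U) uniformity)"
    by (simp add: open_L2_def)
  show "f \<bullet> g = g \<bullet> f"
    by transfer (simp add: inner_commute)
  show "(f + g) \<bullet> h = f \<bullet> h + g \<bullet> h"
    by transfer
      (auto simp: L2_rel_def inner_add_left square_integrable_inner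
            intro!: Bochner_Integration.integral_add)
  show "(a *\<^sub>R f) \<bullet> g = a * (f \<bullet> g)"
    by transfer simp
  show "0 \<le> f \<bullet> f"
    by transfer simp
  show "f \<bullet> f = 0 \<longleftrightarrow> f = 0"
  proof (transfer)
    fix f :: "'a \<Rightarrow> 'b"
    assume "L2_rel f f"
    then have f: "square_integrable f"
      by (simp add: L2_rel_def)
    then have "(LINT x|lebesgue. f x \<bullet> f x) = 0 \<longleftrightarrow> (AE x in lebesgue. f x \<bullet> f x = 0)"
      by (intro integral_nonneg_eq_0_iff_AE square_integrable_inner) auto
    then show "(LINT x|lebesgue. f x \<bullet> f x) = 0 \<longleftrightarrow> L2_rel f (\<lambda>x. 0)"
      using f by (simp add: L2_rel_def square_integrable_0)
  qed
  show "norm f = sqrt (f \<bullet> f)"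
    by (simp add: norm_L2_def)
qed

end

text \<open>$L^2(\Omega)$ is the subspace of the functions vanishing almost everywhere outside $\Omega$,
  that is, functions on $\Omega$ are extended by zero.  On it, the inner product and the norm of the
  type are those of $L^2(\Omega)$.\<close>

definition L2_on :: "'a::euclidean_space set \<Rightarrow> ('a, 'b::euclidean_space) L2 set" where
  "L2_on \<Omega> = {f. AE x in lebesgue. x \<notin> \<Omega> \<longrightarrow> rep_L2 f x = 0}"

section \<open>Operators on finite-dimensional subspaces\<close>

text \<open>The element of \<open>V\<close> representing the linear functional \<open>l\<close> on \<open>V\<close>.\<close>

definition riesz :: "'v::real_inner set \<Rightarrow> ('v \<Rightarrow> real) \<Rightarrow> 'v" where
  "riesz V l = (THE w. w \<in> V \<and> (\<forall>v\<in>V. w \<bullet> v = l v))"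

definition orth_proj :: "'v::real_inner set \<Rightarrow> 'v \<Rightarrow> 'v" where
  "orth_proj E u = (THE w. w \<in> E \<and> (\<forall>v\<in>E. (u - w) \<bullet> v = 0))"

definition eigenspace :: "'v::real_inner set \<Rightarrow> ('v \<Rightarrow> 'v) \<Rightarrow> real \<Rightarrow> 'v set" where
  "eigenspace V A \<mu> = {v \<in> V. A v = \<mu> *\<^sub>R v}"

definition spectrum_on :: "'v::real_inner set \<Rightarrow> ('v \<Rightarrow> 'v) \<Rightarrow> real set" where
  "spectrum_on V A = {\<mu>. \<exists>v\<in>eigenspace V A \<mu>. v \<noteq> 0}"

text \<open>\<open>A\<^sup>a\<close> for a symmetric positive definite operator \<open>A\<close> on the finite-dimensional space \<open>V\<close>:
  the spectrum is finite, and \<open>A\<close> is the sum of its eigenvalues times the orthogonal projections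
  onto the eigenspaces.\<close>

definition frac_power ::
  "'v::real_inner set \<Rightarrow> ('v \<Rightarrow> 'v) \<Rightarrow> real \<Rightarrow> 'v \<Rightarrow> 'v" where
  "frac_power V A a u =
     (\<Sum>\<mu>\<in>spectrum_on V A. (\<mu> powr a) *\<^sub>R orth_proj (eigenspace V A \<mu>) u)"

section \<open>Domains and triangulations\<close>

text \<open>The boundary of an open set has empty interior, so the polytopes below are
  automatically of lower dimension.\<close>

definition bounded_polygonal_domain :: "'a::euclidean_space set \<Rightarrow> bool" where
  "bounded_polygonal_domain \<Omega> \<longleftrightarrow>
     \<Omega> \<noteq> {} \<and> open \<Omega> \<and> connected \<Omega> \<and> bounded \<Omega> \<and>
     (\<exists>\<P>. finite \<P> \<and> (\<forall>P\<in>\<P>. polytope P) \<and> frontier \<Omega> = \<Union>\<P>)"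

text \<open>The library notion \<open>triangulation\<close> (finitely many simplices meeting in common faces) allows
  simplices of any dimension.\<close>

definition triangulates :: "'a::euclidean_space set set \<Rightarrow> 'a set \<Rightarrow> bool" where
  "triangulates \<T> \<Omega> \<longleftrightarrow>
     triangulation \<T> \<and> (\<forall>T\<in>\<T>. int DIM('a) simplex T) \<and> \<Union>\<T> = closure \<Omega>"

definition inradius :: "'a::euclidean_space set \<Rightarrow> real" where
  "inradius T = Sup {\<rho>. 0 \<le> \<rho> \<and> (\<exists>c. cball c \<rho> \<subseteq> T)}"

text \<open>A property of a family of triangulations: the constant is the same for all its members.\<close>

definition shape_regular :: "'a::euclidean_space set set set \<Rightarrow> bool" where
  "shape_regular F \<longleftrightarrow> (\<exists>\<kappa>. \<forall>\<T>\<in>F. \<forall>T\<in>\<T>. diameter T \<le> \<kappa> * inradius T)"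

section \<open>Weak divergence\<close>

definition test_function :: "'a::euclidean_space set \<Rightarrow> ('a \<Rightarrow> real) \<Rightarrow> ('a \<Rightarrow> 'a) \<Rightarrow> bool" where
  "test_function \<Omega> \<phi> \<phi>' \<longleftrightarrow>
     (\<forall>x. GDERIV \<phi> x :> \<phi>' x) \<and> continuous_on UNIV \<phi>' \<and>
     compact (closure {x. \<phi> x \<noteq> 0}) \<and> closure {x. \<phi> x \<noteq> 0} \<subseteq> \<Omega>"

text \<open>Test functions are of class $C^1_c(\Omega)$, as in Gilbarg and Trudinger; by mollification,
  $C^\infty_c(\Omega)$ gives the same notion.\<close>

definition has_weak_div ::
  "'a::euclidean_space set \<Rightarrow> ('a, 'a) L2 \<Rightarrow> ('a, real) L2 \<Rightarrow> bool" where
  "has_weak_div \<Omega> \<sigma> g \<longleftrightarrow>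
     (\<forall>\<phi> \<phi>'. test_function \<Omega> \<phi> \<phi>' \<longrightarrow>
        (LINT x|lebesgue. rep_L2 \<sigma> x \<bullet> \<phi>' x) = - (LINT x|lebesgue. rep_L2 g x * \<phi> x))"

definition Hdiv :: "'a::euclidean_space set \<Rightarrow> ('a, 'a) L2 set" where
  "Hdiv \<Omega> = {\<sigma> \<in> L2_on \<Omega>. \<exists>g\<in>L2_on \<Omega>. has_weak_div \<Omega> \<sigma> g}"

definition weak_div :: "'a::euclidean_space set \<Rightarrow> ('a, 'a) L2 \<Rightarrow> ('a, real) L2" where
  "weak_div \<Omega> \<sigma> = (THE g. g \<in> L2_on \<Omega> \<and> has_weak_div \<Omega> \<sigma> g)"

section \<open>Finite element spaces and discrete operators\<close>

definition poly_fun :: "nat \<Rightarrow> (real^'n \<Rightarrow> real) set" where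
  "poly_fun r =
     {p. \<exists>c. p = (\<lambda>x. \<Sum>\<alpha> | (\<Sum>i\<in>UNIV. \<alpha> i) \<le> r. c \<alpha> * (\<Prod>i\<in>UNIV. (x $ i) ^ \<alpha> i))}"

definition RT_fun :: "nat \<Rightarrow> (real^'n \<Rightarrow> real^'n) set" where
  "RT_fun r =
     {(\<lambda>x. p x + q x *\<^sub>R x) | p q. (\<forall>i. (\<lambda>x. p x $ i) \<in> poly_fun r) \<and> q \<in> poly_fun r}"

definition S_space :: "(real^'n) set \<Rightarrow> (real^'n) set set \<Rightarrow> nat \<Rightarrow> (real^'n, real) L2 set" where
  "S_space \<Omega> \<T> r =
     {u \<in> L2_on \<Omega>. \<forall>T\<in>\<T>. \<exists>p\<in>poly_fun r. AE x in lebesgue. x \<in> T \<longrightarrow> rep_L2 u x = p x}"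

definition V_space :: "(real^'n) set \<Rightarrow> (real^'n) set set \<Rightarrow> nat \<Rightarrow> (real^'n, real^'n) L2 set" where
  "V_space \<Omega> \<T> r =
     {\<sigma> \<in> Hdiv \<Omega>. \<forall>T\<in>\<T>. \<exists>p\<in>RT_fun r. AE x in lebesgue. x \<in> T \<longrightarrow> rep_L2 \<sigma> x = p x}"

definition discrete_grad ::
  "(real^'n) set \<Rightarrow> (real^'n) set set \<Rightarrow> nat \<Rightarrow> (real^'n, real) L2 \<Rightarrow> (real^'n, real^'n) L2" where
  "discrete_grad \<Omega> \<T> r u = riesz (V_space \<Omega> \<T> r) (\<lambda>\<tau>. - (u \<bullet> weak_div \<Omega> \<tau>))"

definition discrete_laplacian ::
  "(real^'n) set \<Rightarrow> (real^'n) set set \<Rightarrow> nat \<Rightarrow> (real^'n, real) L2 \<Rightarrow> (real^'n, real) L2" where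
  "discrete_laplacian \<Omega> \<T> r u =
     riesz (S_space \<Omega> \<T> r) (\<lambda>v. discrete_grad \<Omega> \<T> r u \<bullet> discrete_grad \<Omega> \<T> r v)"

definition Lambda_op ::
  "(real^'n) set \<Rightarrow> (real^'n) set set \<Rightarrow> nat \<Rightarrow> (real^'n, real^'n) L2 \<Rightarrow> (real^'n, real^'n) L2" where
  "Lambda_op \<Omega> \<T> r \<sigma> =
     riesz (V_space \<Omega> \<T> r) (\<lambda>\<tau>. \<sigma> \<bullet> \<tau> + weak_div \<Omega> \<sigma> \<bullet> weak_div \<Omega> \<tau>)"

end

theory Submission
  imports Defs
begin

text \<open>
  Write \<open>d\<close> for the weak divergence on the Raviart--Thomas space \<open>V\<close>. As \<open>d\<close> maps \<open>V\<close> into the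
  space \<open>S\<close> of piecewise polynomials, the discrete gradient \<open>G\<close> is minus the adjoint of \<open>d : V \<rightarrow>
  S\<close>, so the discrete Laplacian is \<open>A = G\<^sup>* G\<close> and \<open>\<Lambda> = 1 + G G\<^sup>*\<close>. These two operators are
  diagonalised together: if \<open>A e = \<mu> e\<close>, then \<open>\<Lambda> (G e) = (1 + \<mu>) G e\<close> and \<open>\<parallel>G e\<parallel>\<^sup>2 = \<mu> \<parallel>e\<parallel>\<^sup>2\<close>. For
  \<open>u = \<Sum> c\<^sub>i e\<^sub>i\<close> in an orthonormal basis of eigenvectors of \<open>A\<close>, with eigenvalues \<open>\<mu>\<^sub>i\<close>, the two
  quadratic forms are therefore the sums of \<open>c\<^sub>i\<^sup>2 \<mu>\<^sub>i powr s\<close> and of \<open>c\<^sub>i\<^sup>2 \<mu>\<^sub>i (1 + \<mu>\<^sub>i) powr (s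
  - 1)\<close>, and they can be compared term by term. The upper bound is \<open>\<mu> \<le> 1 + \<mu>\<close>. For the lower
  bound, the inf-sup condition is applied to \<open>u = e\<^sub>i\<close>: by the Cauchy--Schwarz inequality for the
  inner product of \<open>\<Lambda>\<close>, the supremum is at most \<open>sqrt (\<mu>\<^sub>i / (1 + \<mu>\<^sub>i))\<close>, so \<open>\<beta>\<^sup>2 \<le> \<mu>\<^sub>i / (1 +
  \<mu>\<^sub>i)\<close>. This is \<open>inf_sup_fractional_bounds\<close>.

  The argument uses three further facts. Symmetric operators on finite-dimensional subspaces of an
  inner product space have orthonormal eigenbases (\<open>spectral_theorem\<close>, by maximising Rayleigh
  quotients). The spaces \<open>S\<close> and \<open>V\<close> are finite-dimensional, because the mesh cuts the domain into
  finitely many pieces on each of which a function is a combination of finitely many monomials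
  (\<open>piecewise_finite_dimensional\<close>). Finally \<open>d\<close> maps \<open>V\<close> into \<open>S\<close> (\<open>weak_div_V_space_in_S_space\<close>):
  inside a simplex, test functions and integration by parts identify the weak divergence with the
  classical divergence of a Raviart--Thomas polynomial, which has degree at most \<open>r\<close>, and the
  boundaries of the simplices and of the domain are null sets. The identification rests on the
  fundamental lemma of the calculus of variations (\<open>fundamental_lemma\<close>), which also makes the weak
  divergence unique.
\<close>

section \<open>Finite-dimensional subspaces\<close>

text \<open>The ambient space is a general inner product space such as $L^2$, so finiteness of the
  dimension is a property of the subspace, witnessed by a finite spanning set.\<close>

definition finite_dim_subspace :: "'v::real_inner set \<Rightarrow> bool" where
  "finite_dim_subspace V \<longleftrightarrow> subspace V \<and> (\<exists>B. finite B \<and> V \<subseteq> span B)"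

definition orthonormal :: "'v::real_inner set \<Rightarrow> bool" where
  "orthonormal E \<longleftrightarrow> (\<forall>x\<in>E. \<forall>y\<in>E. x \<bullet> y = (if x = y then 1 else 0))"

lemma orthonormal_independent:
  assumes "orthonormal E" shows "independent E"
proof (rule pairwise_orthogonal_independent)
  show "pairwise orthogonal E"
    using assms by (auto simp: orthonormal_def pairwise_def orthogonal_def)
  show "0 \<notin> E"
    using assms by (force simp: orthonormal_def)
qed

lemma orthonormal_basis_exists:
  assumes "finite_dim_subspace V"
  obtains E where "finite E" "orthonormal E" "span E = V"
proof -
  from assms obtain B where V: "subspace V" and B: "finite B" "V \<subseteq> span B"
    by (auto simp: finite_dim_subspace_def)
  obtain B' where B': "B' \<subseteq> V" "independent B'" "V \<subseteq> span B'"
    using maximal_independent_subset by blast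
  then have "finite B'"
    using independent_span_bound[of B B'] B by blast
  then obtain C where C: "finite C" "span C = span B'" "pairwise orthogonal C"
    using basis_orthogonal by blast
  have sC: "span C = V"
    using B' C V by (metis span_subspace)
  define E where "E = (\<lambda>x. x /\<^sub>R norm x) ` (C - {0})"
  have 1: "finite E"
    using C by (simp add: E_def)
  have 2: "orthonormal E"
    unfolding orthonormal_def
  proof (intro ballI)
    fix x y assume "x \<in> E" "y \<in> E"
    then obtain a b where ab: "a \<in> C" "a \<noteq> 0" "x = a /\<^sub>R norm a" "b \<in> C" "b \<noteq> 0" "y = b /\<^sub>R norm b"
      by (auto simp: E_def)
    show "x \<bullet> y = (if x = y then 1 else 0)"
    proof (cases "a = b")
      case True
      then show ?thesis
        using ab by (simp add: dot_square_norm power2_eq_square)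
    next
      case False
      then have z: "a \<bullet> b = 0"
        using C ab by (auto simp: pairwise_def orthogonal_def)
      then have "x \<bullet> y = 0"
        using ab by simp
      moreover have "x \<noteq> y"
      proof
        assume "x = y"
        then have "x \<bullet> x = 0" using \<open>x \<bullet> y = 0\<close> by simp
        then show False using ab by simp
      qed
      ultimately show ?thesis by simp
    qed
  qed
  have "span E = span (C - {0})"
    unfolding E_def by (rule span_image_scale) (use C in auto)
  then have 3: "span E = V"
    using sC by (simp add: span_delete_0)
  show thesis
    using that 1 2 3 by blast
qed

lemma orthonormal_expansion:
  assumes "finite E" "orthonormal E" "v \<in> span E"
  shows "v = (\<Sum>e\<in>E. (v \<bullet> e) *\<^sub>R e)"
  using assms(3)
proof (induction rule: span_induct)
  case base
  let ?f = "\<lambda>v. \<Sum>e\<in>E. (v \<bullet> e) *\<^sub>R e"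
  have "?f (x + y) = ?f x + ?f y" "?f (c *\<^sub>R x) = c *\<^sub>R ?f x" for x y c
    by (simp_all add: inner_add_left scaleR_add_left sum.distrib scaleR_right.sum)
  then show ?case
    unfolding subspace_def mem_Collect_eq by simp
next
  case (step x)
  then have "(\<Sum>e\<in>E. (x \<bullet> e) *\<^sub>R e) = (\<Sum>e\<in>E. if x = e then e else 0)"
    using assms by (intro sum.cong) (auto simp: orthonormal_def)
  with step show ?case
    using assms by simp
qed

lemma finite_dim_subspaceD:
  assumes "finite_dim_subspace V"
  shows "0 \<in> V" "x \<in> V \<Longrightarrow> y \<in> V \<Longrightarrow> x + y \<in> V" "x \<in> V \<Longrightarrow> c *\<^sub>R x \<in> V"
    "x \<in> V \<Longrightarrow> y \<in> V \<Longrightarrow> x - y \<in> V" "x \<in> V \<Longrightarrow> - x \<in> V"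
  using assms by (auto simp: finite_dim_subspace_def subspace_def subspace_diff subspace_neg)

definition linear_on_subspace :: "'v::real_vector set \<Rightarrow> ('v \<Rightarrow> 'w::real_vector) \<Rightarrow> bool" where
  "linear_on_subspace V f \<longleftrightarrow>
     (\<forall>x\<in>V. \<forall>y\<in>V. f (x + y) = f x + f y) \<and> (\<forall>c. \<forall>x\<in>V. f (c *\<^sub>R x) = c *\<^sub>R f x)"

lemma linear_on_subspace_expansion:
  assumes "linear_on_subspace V f" "finite E" "orthonormal E" "span E = V" "v \<in> V"
  shows "f v = (\<Sum>e\<in>E. (v \<bullet> e) *\<^sub>R f e)"
proof -
  have EV: "E \<subseteq> V"
    using assms span_superset by blast
  have sV: "subspace V"
    using assms by auto
  have f: "\<And>x y. x \<in> V \<Longrightarrow> y \<in> V \<Longrightarrow> f (x + y) = f x + f y"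
    "\<And>c x. x \<in> V \<Longrightarrow> f (c *\<^sub>R x) = c *\<^sub>R f x"
    using assms by (auto simp: linear_on_subspace_def)
  have f0: "f 0 = 0"
    using f(2)[of 0 0] sV by (simp add: subspace_0)
  have "f (\<Sum>e\<in>F. c e *\<^sub>R e) = (\<Sum>e\<in>F. c e *\<^sub>R f e) \<and> (\<Sum>e\<in>F. c e *\<^sub>R e) \<in> V"
    if "finite F" "F \<subseteq> V" for F c
    using that
    by (induction F) (auto simp: f f0 sV subspace_0 subspace_add subspace_scale)
  from this[of E "\<lambda>e. v \<bullet> e"] show ?thesis
    using orthonormal_expansion[of E v] assms EV by auto
qed

lemma eq_if_inner_eq:
  assumes "finite_dim_subspace V" "x \<in> V" "y \<in> V" "\<And>v. v \<in> V \<Longrightarrow> x \<bullet> v = y \<bullet> v"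
  shows "x = y"
proof -
  have "(x - y) \<bullet> (x - y) = 0"
    using assms(4)[of "x - y"] finite_dim_subspaceD(4)[OF assms(1-3)] by (simp add: inner_diff_left)
  then show ?thesis by simp
qed

lemma riesz_representation:
  assumes V: "finite_dim_subspace V" and l: "linear_on_subspace V l"
  shows "riesz V l \<in> V" and "v \<in> V \<Longrightarrow> riesz V l \<bullet> v = l v"
proof -
  obtain E where E: "finite E" "orthonormal E" "span E = V"
    using orthonormal_basis_exists V by blast
  define w where "w = (\<Sum>e\<in>E. l e *\<^sub>R e)"
  have w: "w \<in> V"
    unfolding w_def E(3)[symmetric] by (intro span_sum span_scale span_base)
  have wl: "w \<bullet> v = l v" if "v \<in> V" for v
    using linear_on_subspace_expansion[OF l E that]
    unfolding w_def inner_sum_left by (simp add: inner_commute[of v] mult.commute)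
  have "\<exists>!w. w \<in> V \<and> (\<forall>v\<in>V. w \<bullet> v = l v)"
    using w wl eq_if_inner_eq[OF V] by (metis (no_types, lifting))
  from theI'[OF this] show "riesz V l \<in> V" and "v \<in> V \<Longrightarrow> riesz V l \<bullet> v = l v"
    unfolding riesz_def by auto
qed

section \<open>Symmetric operators\<close>

text \<open>Operators on a subspace are total functions with unspecified values outside it. Linearity on
  \<open>V\<close> is a consequence of symmetry, proved next.\<close>

definition symmetric_operator :: "'v::real_inner set \<Rightarrow> ('v \<Rightarrow> 'v) \<Rightarrow> bool" where
  "symmetric_operator V A \<longleftrightarrow> (\<forall>x\<in>V. A x \<in> V) \<and> (\<forall>x\<in>V. \<forall>y\<in>V. A x \<bullet> y = x \<bullet> A y)"

lemma symmetric_operator_linear: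
  assumes V: "finite_dim_subspace V" and A: "symmetric_operator V A"
  shows "linear_on_subspace V A"
  unfolding linear_on_subspace_def
proof (intro conjI ballI allI)
  note D = finite_dim_subspaceD[OF V]
  have s: "\<And>x. x \<in> V \<Longrightarrow> A x \<in> V" "\<And>x y. x \<in> V \<Longrightarrow> y \<in> V \<Longrightarrow> A x \<bullet> y = x \<bullet> A y"
    using A by (auto simp: symmetric_operator_def)
  show "A (x + y) = A x + A y" if "x \<in> V" "y \<in> V" for x y
    by (rule eq_if_inner_eq[OF V]) (use that in \<open>auto simp: s D inner_add_left\<close>)
  show "A (c *\<^sub>R x) = c *\<^sub>R A x" if "x \<in> V" for x c
    by (rule eq_if_inner_eq[OF V]) (use that in \<open>auto simp: s D\<close>)
qed

text \<open>A unit vector has coordinates in \<open>[-1, 1]\<close>, so the sphere is a closed subset of the image of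
  a cube under addition and scaling; the image is compact by induction on the basis.\<close>

lemma compact_unit_sphere:
  assumes "finite E" "orthonormal E"
  shows "compact {v \<in> span E. norm v = 1}"
proof -
  have "compact {\<Sum>e\<in>F. c e *\<^sub>R e | c. \<forall>e\<in>F. \<bar>c e\<bar> \<le> 1}" (is "compact (?Q F)") if "finite F" for F :: "'a set"
    using that
  proof (induction F)
    case empty
    then show ?case by simp
  next
    case (insert b F)
    have "?Q (insert b F) = (\<lambda>(t, q). t *\<^sub>R b + q) ` ({-1..1} \<times> ?Q F)" (is "_ = ?R")
    proof (intro equalityI subsetI)
      fix x assume "x \<in> ?Q (insert b F)"
      then obtain c where "x = (\<Sum>e\<in>insert b F. c e *\<^sub>R e)" "\<forall>e\<in>insert b F. \<bar>c e\<bar> \<le> 1"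
        by blast
      with insert show "x \<in> ?R"
        by (intro image_eqI[where x = "(c b, \<Sum>e\<in>F. c e *\<^sub>R e)"]) auto
    next
      fix x assume "x \<in> ?R"
      then obtain p where p: "p \<in> {-1..1} \<times> ?Q F" "x = (\<lambda>(t, q). t *\<^sub>R b + q) p"
        by blast
      then have tq: "fst p \<in> {-1..1}" "snd p \<in> ?Q F" "x = fst p *\<^sub>R b + snd p"
        by (auto simp: case_prod_unfold)
      define t where "t = fst p"
      from tq(2) obtain c where "snd p = (\<Sum>e\<in>F. c e *\<^sub>R e)" "\<forall>e\<in>F. \<bar>c e\<bar> \<le> 1"
        by blast
      with tq have tc: "\<bar>t\<bar> \<le> 1" "x = t *\<^sub>R b + (\<Sum>e\<in>F. c e *\<^sub>R e)" "\<forall>e\<in>F. \<bar>c e\<bar> \<le> 1"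
        by (auto simp: t_def)
      have "(\<Sum>e\<in>F. c e *\<^sub>R e) = (\<Sum>e\<in>F. (c(b := t)) e *\<^sub>R e)"
        using insert by (intro sum.cong) auto
      with tc insert show "x \<in> ?Q (insert b F)"
        by (intro CollectI exI[of _ "c(b := t)"]) auto
    qed
    moreover have "continuous_on X (\<lambda>(t, q). t *\<^sub>R b + q)" for X :: "(real \<times> 'a) set"
      by (auto simp: case_prod_unfold intro!: continuous_intros)
    ultimately show ?case
      using insert.IH by (simp only:) (intro compact_continuous_image compact_Times compact_Icc)
  qed
  from this[OF assms(1)] have "compact ({\<Sum>e\<in>E. c e *\<^sub>R e | c. \<forall>e\<in>E. \<bar>c e\<bar> \<le> 1} \<inter> {v. norm v = 1})"
    by (intro compact_Int_closed closed_Collect_eq continuous_intros)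
  moreover have "{v \<in> span E. norm v = 1} = {\<Sum>e\<in>E. c e *\<^sub>R e | c. \<forall>e\<in>E. \<bar>c e\<bar> \<le> 1} \<inter> {v. norm v = 1}"
  proof (intro equalityI subsetI)
    fix v assume v: "v \<in> {v \<in> span E. norm v = 1}"
    have "norm e = 1" if "e \<in> E" for e
      using that assms by (simp add: norm_eq_sqrt_inner orthonormal_def)
    then have "\<bar>v \<bullet> e\<bar> \<le> 1" if "e \<in> E" for e
      using Cauchy_Schwarz_ineq2[of v e] v that by simp
    then show "v \<in> {\<Sum>e\<in>E. c e *\<^sub>R e | c. \<forall>e\<in>E. \<bar>c e\<bar> \<le> 1} \<inter> {v. norm v = 1}"
      using orthonormal_expansion[of E v] assms v by auto
  qed (auto intro: span_sum span_scale span_base)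
  ultimately show ?thesis by simp
qed

text \<open>A maximiser of the Rayleigh quotient on an invariant subspace is an eigenvector, because
  there the first variation of \<open>A v \<bullet> v - \<mu> (v \<bullet> v)\<close> vanishes.\<close>

lemma eigenvector_exists:
  assumes V: "finite_dim_subspace V" and A: "symmetric_operator V A" and E: "finite E" "orthonormal E" "span E = V"
    and W: "subspace W" "closed W" "W \<subseteq> V" "\<And>w. w \<in> W \<Longrightarrow> A w \<in> W" and x: "x \<in> W" "x \<noteq> 0"
  obtains \<mu> w where "w \<in> W" "norm w = 1" "A w = \<mu> *\<^sub>R w"
proof -
  have s: "\<And>x. x \<in> V \<Longrightarrow> A x \<in> V" "\<And>x y. x \<in> V \<Longrightarrow> y \<in> V \<Longrightarrow> A x \<bullet> y = x \<bullet> A y"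
    using A by (auto simp: symmetric_operator_def)
  note lin = symmetric_operator_linear[OF V A]
  have add: "A (x + y) = A x + A y" and scale: "A (c *\<^sub>R x) = c *\<^sub>R A x" if "x \<in> V" "y \<in> V" for x y c
    using lin that by (auto simp: linear_on_subspace_def)
  define f where "f = (\<lambda>v. A v \<bullet> v)"
  define K where "K = {v \<in> span E. norm v = 1} \<inter> W"
  have "compact K"
    unfolding K_def using compact_unit_sphere[OF E(1,2)] W by (intro compact_Int_closed) auto
  moreover have "K \<noteq> {}"
  proof -
    have "x /\<^sub>R norm x \<in> K"
      using x W E by (auto simp: K_def subspace_scale)
    then show ?thesis by blast
  qed
  moreover have "continuous_on K f"
  proof -
    have "continuous_on K (\<lambda>v. (\<Sum>e\<in>E. (v \<bullet> e) *\<^sub>R A e) \<bullet> v)"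
      by (intro continuous_intros)
    then show ?thesis
      by (rule continuous_on_eq)
        (use linear_on_subspace_expansion[OF lin E] W in \<open>auto simp: K_def f_def\<close>)
  qed
  ultimately obtain w where w: "w \<in> K" "\<And>v. v \<in> K \<Longrightarrow> f v \<le> f w"
    using continuous_attains_sup[of K f] by auto
  define \<mu> where "\<mu> = f w"
  have wW: "w \<in> W" "norm w = 1"
    using w by (auto simp: K_def)
  have le: "A v \<bullet> v \<le> \<mu> * (v \<bullet> v)" if "v \<in> W" for v
  proof (cases "v = 0")
    case False
    define c where "c = inverse (norm v)"
    have vV: "v \<in> V" using that W by auto
    have "c *\<^sub>R v \<in> K"
      using that W E False by (auto simp: K_def subspace_scale c_def)
    then have "f (c *\<^sub>R v) \<le> \<mu>"
      using w by (simp add: \<mu>_def)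
    then have "c * c * (A v \<bullet> v) \<le> \<mu>"
      using vV by (simp add: f_def scale mult.assoc)
    moreover have "c * c * (v \<bullet> v) = 1"
      using False by (simp add: c_def dot_square_norm power2_eq_square field_simps)
    ultimately have "c * c * (A v \<bullet> v) \<le> c * c * (\<mu> * (v \<bullet> v))"
      by (simp add: mult.left_commute)
    moreover have "c * c > 0"
      using False by (simp add: c_def)
    ultimately show ?thesis by (simp only: mult_le_cancel_left_pos)
  qed (simp)
  have ww: "w \<bullet> w = 1"
    using wW by (simp add: dot_square_norm)
  define z where "z = A w - \<mu> *\<^sub>R w"
  have zW: "z \<in> W"
    using wW W by (simp add: z_def subspace_diff subspace_scale)
  have q: "2 * t * (z \<bullet> z) \<le> t\<^sup>2 * (\<mu> * (z \<bullet> z) - A z \<bullet> z)" for t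
  proof -
    have V': "w \<in> V" "z \<in> V" using wW zW W by auto
    have tz: "t *\<^sub>R z \<in> V" using finite_dim_subspaceD[OF V] V' by simp
    have "A (w + t *\<^sub>R z) \<bullet> (w + t *\<^sub>R z) \<le> \<mu> * ((w + t *\<^sub>R z) \<bullet> (w + t *\<^sub>R z))"
      using wW zW W by (intro le) (simp add: subspace_add subspace_scale)
    moreover have "A z \<bullet> w = z \<bullet> A w" using V' s by simp
    ultimately have "2 * t * (z \<bullet> A w - \<mu> * (z \<bullet> w)) \<le> t\<^sup>2 * (\<mu> * (z \<bullet> z) - A z \<bullet> z)"
      using V' tz ww
      by (simp add: add scale inner_add_left inner_add_right \<mu>_def f_def inner_commute
          power2_eq_square algebra_simps)
    moreover have "z \<bullet> A w - \<mu> * (z \<bullet> w) = z \<bullet> z"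
      by (simp add: z_def inner_diff_right)
    ultimately show ?thesis by simp
  qed
  have "z \<bullet> z = 0"
  proof (rule ccontr)
    assume "z \<bullet> z \<noteq> 0"
    then have p: "z \<bullet> z > 0" by (simp add: less_le)
    define d where "d = \<bar>\<mu> * (z \<bullet> z) - A z \<bullet> z\<bar> + 1"
    \<comment> \<open>For this \<open>t\<close>, the right-hand side of \<open>q\<close> is at most half of the left-hand side.\<close>
    define t where "t = (z \<bullet> z) / d"
    have d: "d > 0" "\<mu> * (z \<bullet> z) - A z \<bullet> z \<le> d" by (auto simp: d_def)
    have "t > 0" using p d by (simp add: t_def)
    have "2 * t * (z \<bullet> z) \<le> t\<^sup>2 * d"
      using q[of t] d by (meson mult_left_mono order_trans zero_le_power2)
    also have "\<dots> = t * (z \<bullet> z)"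
      using d by (simp add: t_def power2_eq_square)
    finally show False
      using \<open>t > 0\<close> p by (auto simp: mult_less_0_iff)
  qed
  then have "A w = \<mu> *\<^sub>R w" by (simp add: z_def)
  with wW that show thesis by blast
qed

text \<open>An orthonormal set of eigenvectors of maximal cardinality spans \<open>V\<close>: otherwise its
  orthogonal complement in \<open>V\<close> is nonzero and invariant, and so contains one more eigenvector.\<close>

lemma spectral_theorem:
  assumes V: "finite_dim_subspace V" and A: "symmetric_operator V A"
  obtains E \<mu> where "finite E" "orthonormal E" "span E = V" "\<And>e. e \<in> E \<Longrightarrow> A e = \<mu> e *\<^sub>R e"
proof -
  obtain E0 where E0: "finite E0" "orthonormal E0" "span E0 = V"
    using orthonormal_basis_exists V by blast
  have s: "\<And>x. x \<in> V \<Longrightarrow> A x \<in> V" "\<And>x y. x \<in> V \<Longrightarrow> y \<in> V \<Longrightarrow> A x \<bullet> y = x \<bullet> A y"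
    using A by (auto simp: symmetric_operator_def)
  define P where "P = (\<lambda>E. E \<subseteq> V \<and> orthonormal E \<and> (\<forall>e\<in>E. \<exists>\<mu>. A e = \<mu> *\<^sub>R e))"
  have bound: "finite E \<and> card E \<le> card E0" if "P E" for E
    using that independent_span_bound[OF E0(1), of E] orthonormal_independent[of E] E0
    by (auto simp: P_def)
  have "P {}" by (simp add: P_def orthonormal_def)
  moreover have "\<forall>E. P E \<longrightarrow> card E < Suc (card E0)"
    using bound by (auto simp: less_Suc_eq_le)
  ultimately obtain E where E: "P E" "\<And>F. P F \<Longrightarrow> card F \<le> card E"
    using Lattices_Big.ex_has_greatest_nat[of P "{}" card "Suc (card E0)"] by blast
  have fin: "finite E" and EV: "E \<subseteq> V" and oE: "orthonormal E"
    and ev: "\<forall>e\<in>E. \<exists>\<mu>. A e = \<mu> *\<^sub>R e"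
    using E bound by (auto simp: P_def)
  have sV: "subspace V" using V by (simp add: finite_dim_subspace_def)
  have "V \<subseteq> span E"
  proof (rule ccontr)
    assume "\<not> V \<subseteq> span E"
    then obtain v where v: "v \<in> V" "v \<notin> span E" by blast
    define x where "x = v - (\<Sum>e\<in>E. (v \<bullet> e) *\<^sub>R e)"
    define W where "W = V \<inter> (\<Inter>e\<in>E. {w. w \<bullet> e = 0})"
    have sW: "subspace W"
      using sV by (auto simp: W_def subspace_def inner_add_left)
    have pV: "(\<Sum>e\<in>E. (v \<bullet> e) *\<^sub>R e) \<in> V"
      using EV by (intro subspace_sum[OF sV] subspace_scale[OF sV]) auto
    have xW: "x \<in> W"
    proof -
      have "x \<bullet> e = 0" if e: "e \<in> E" for e
      proof -
        have "(\<Sum>e'\<in>E. (v \<bullet> e') *\<^sub>R e') \<bullet> e = (\<Sum>e'\<in>E. if e' = e then v \<bullet> e' else 0)"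
          using oE e by (auto simp: inner_sum_left orthonormal_def intro!: sum.cong)
        also have "\<dots> = v \<bullet> e" using fin e by simp
        finally show ?thesis by (simp add: x_def inner_diff_left)
      qed
      then show ?thesis using v pV sV by (auto simp: W_def x_def subspace_diff)
    qed
    have x0: "x \<noteq> 0"
    proof
      assume "x = 0"
      then have "v = (\<Sum>e\<in>E. (v \<bullet> e) *\<^sub>R e)" by (simp add: x_def)
      also have "\<dots> \<in> span E" by (intro span_sum span_scale span_base)
      finally show False using v by simp
    qed
    have AW: "A w \<in> W" if w: "w \<in> W" for w
    proof -
      have "A w \<bullet> e = 0" if e: "e \<in> E" for e
      proof -
        from ev e obtain \<mu> where "A e = \<mu> *\<^sub>R e" by blast
        then show ?thesis using s(2)[of w e] w e EV by (auto simp: W_def)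
      qed
      then show ?thesis using w s by (auto simp: W_def)
    qed
    have cW: "closed W"
      \<comment> \<open>\<open>V\<close> is the set of the vectors that agree with their expansion in the basis \<open>E0\<close>.\<close>
    proof -
      have "V = {v. v = (\<Sum>e\<in>E0. (v \<bullet> e) *\<^sub>R e)}"
      proof (intro equalityI subsetI)
        show "v \<in> {v. v = (\<Sum>e\<in>E0. (v \<bullet> e) *\<^sub>R e)}" if "v \<in> V" for v
          using orthonormal_expansion[OF E0(1,2)] E0 that by auto
        show "v \<in> V" if "v \<in> {v. v = (\<Sum>e\<in>E0. (v \<bullet> e) *\<^sub>R e)}" for v
        proof -
          have "(\<Sum>e\<in>E0. (v \<bullet> e) *\<^sub>R e) \<in> span E0"
            by (intro span_sum span_scale span_base)
          with that E0 show ?thesis by simp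
        qed
      qed
      moreover have "closed {v. v = (\<Sum>e\<in>E0. (v \<bullet> e) *\<^sub>R e)}"
        by (intro closed_Collect_eq continuous_intros)
      ultimately have "closed V" by simp
      moreover have "closed {w. w \<bullet> e = 0}" for e :: 'a
        by (intro closed_Collect_eq continuous_intros)
      ultimately show ?thesis by (auto simp: W_def)
    qed
    have WV: "W \<subseteq> V" by (simp add: W_def)
    obtain \<mu> w where w: "w \<in> W" "norm w = 1" "A w = \<mu> *\<^sub>R w"
      by (rule eigenvector_exists[OF V A E0 sW cW WV AW xW x0])
    have ww: "w \<bullet> w = 1" using w by (simp add: dot_square_norm)
    have "w \<notin> E" using w ww by (auto simp: W_def)
    moreover have "P (insert w E)"
      using E(1) w ww by (auto simp: P_def W_def orthonormal_def inner_commute)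
    ultimately show False
      using E(2)[of "insert w E"] fin by simp
  qed
  then have "span E = V"
    using EV sV span_minimal by blast
  moreover obtain \<mu> where "\<forall>e\<in>E. A e = \<mu> e *\<^sub>R e"
    using ev by metis
  ultimately show thesis
    using that fin oE by blast
qed

section \<open>Fractional powers\<close>

lemma orth_proj_eqI:
  assumes "subspace E" "w \<in> E" "\<And>v. v \<in> E \<Longrightarrow> (u - w) \<bullet> v = 0"
  shows "orth_proj E u = w"
  unfolding orth_proj_def
proof (rule the_equality)
  fix w' assume w': "w' \<in> E \<and> (\<forall>v\<in>E. (u - w') \<bullet> v = 0)"
  have "w - w' \<in> E" using assms w' by (simp add: subspace_diff)
  then have "(u - w') \<bullet> (w - w') - (u - w) \<bullet> (w - w') = 0"
    using assms w' by simp
  then have "(w - w') \<bullet> (w - w') = 0"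
    by (simp add: inner_diff_left)
  then show "w' = w" by simp
qed (use assms in blast)

lemma finite_spectrum:
  assumes V: "finite_dim_subspace V" and A: "symmetric_operator V A"
  shows "finite (spectrum_on V A)"
proof -
  obtain E \<mu> where E: "finite E" "orthonormal E" "span E = V" "\<And>e. e \<in> E \<Longrightarrow> A e = \<mu> e *\<^sub>R e"
    using spectral_theorem[OF V A] by blast
  have "spectrum_on V A \<subseteq> \<mu> ` E"
  proof
    fix \<nu> assume "\<nu> \<in> spectrum_on V A"
    then obtain v where v: "v \<in> V" "A v = \<nu> *\<^sub>R v" "v \<noteq> 0"
      by (auto simp: spectrum_on_def eigenspace_def)
    then obtain e where e: "e \<in> E" "v \<bullet> e \<noteq> 0"
      using orthonormal_expansion[OF E(1,2), of v] E(3)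
      by (metis (no_types, lifting) scaleR_zero_left sum.neutral)
    have "e \<in> V" using e E(3) span_base by blast
    then have "A v \<bullet> e = v \<bullet> A e"
      using A v by (auto simp: symmetric_operator_def)
    then have "\<nu> = \<mu> e" using v e E(4) by simp
    then show "\<nu> \<in> \<mu> ` E" using e by blast
  qed
  then show ?thesis using E finite_surj by blast
qed

lemma subspace_eigenspace:
  assumes V: "finite_dim_subspace V" and A: "symmetric_operator V A"
  shows "subspace (eigenspace V A \<mu>)"
  using symmetric_operator_linear[OF V A] finite_dim_subspaceD[OF V]
  unfolding subspace_def eigenspace_def linear_on_subspace_def
  by (auto simp: scaleR_add_right) (metis scaleR_zero_left)

text \<open>Eigenspaces of different eigenvalues are orthogonal, so projecting a sum of eigenvectors
  onto an eigenspace selects the summands that belong to it. Hence fractional powers can be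
  computed from any decomposition into eigenvectors.\<close>

lemma frac_power_sum_eigenvectors:
  assumes V: "finite_dim_subspace V" and A: "symmetric_operator V A"
    and I: "finite I" "\<And>i. i \<in> I \<Longrightarrow> x i \<in> V" "\<And>i. i \<in> I \<Longrightarrow> A (x i) = \<mu> i *\<^sub>R x i"
  shows "frac_power V A a (\<Sum>i\<in>I. x i) = (\<Sum>i\<in>I. \<mu> i powr a *\<^sub>R x i)"
proof -
  let ?S = "spectrum_on V A"
  have fin: "finite ?S" using finite_spectrum[OF V A] .
  have proj: "orth_proj (eigenspace V A \<nu>) (\<Sum>i\<in>I. x i) = (\<Sum>i\<in>I. if \<mu> i = \<nu> then x i else 0)" for \<nu>
  proof (rule orth_proj_eqI)
    show sub: "subspace (eigenspace V A \<nu>)" by (rule subspace_eigenspace[OF V A])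
    show "(\<Sum>i\<in>I. if \<mu> i = \<nu> then x i else 0) \<in> eigenspace V A \<nu>"
    proof (rule subspace_sum[OF sub])
      show "(if \<mu> i = \<nu> then x i else 0) \<in> eigenspace V A \<nu>" if "i \<in> I" for i
        using I that subspace_0[OF sub] by (auto simp: eigenspace_def)
    qed
    fix v assume v: "v \<in> eigenspace V A \<nu>"
    have "x i \<bullet> v = 0" if i: "i \<in> I" "\<mu> i \<noteq> \<nu>" for i
    proof -
      have "A (x i) \<bullet> v = x i \<bullet> A v"
        using A I(2)[OF i(1)] v unfolding symmetric_operator_def eigenspace_def by blast
      then have "(\<mu> i - \<nu>) * (x i \<bullet> v) = 0"
        using I i v by (simp add: eigenspace_def left_diff_distrib)
      then show ?thesis using i by simp
    qed
    then have "(\<Sum>i\<in>I. (x i - (if \<mu> i = \<nu> then x i else 0)) \<bullet> v) = 0"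
      by (intro sum.neutral) auto
    then show "((\<Sum>i\<in>I. x i) - (\<Sum>i\<in>I. if \<mu> i = \<nu> then x i else 0)) \<bullet> v = 0"
      by (simp add: sum_subtractf[symmetric] inner_sum_left)
  qed
  have "frac_power V A a (\<Sum>i\<in>I. x i) = (\<Sum>\<nu>\<in>?S. \<nu> powr a *\<^sub>R (\<Sum>i\<in>I. if \<mu> i = \<nu> then x i else 0))"
    by (simp add: frac_power_def proj)
  also have "\<dots> = (\<Sum>i\<in>I. \<Sum>\<nu>\<in>?S. \<nu> powr a *\<^sub>R (if \<mu> i = \<nu> then x i else 0))"
    by (subst sum.swap) (simp add: scaleR_right.sum)
  also have "\<dots> = (\<Sum>i\<in>I. \<mu> i powr a *\<^sub>R x i)"
  proof (rule sum.cong[OF refl])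
    fix i assume i: "i \<in> I"
    have "(\<Sum>\<nu>\<in>?S. \<nu> powr a *\<^sub>R (if \<mu> i = \<nu> then x i else 0)) = (\<Sum>\<nu>\<in>?S. if \<mu> i = \<nu> then \<nu> powr a *\<^sub>R x i else 0)"
      by (intro sum.cong) auto
    also have "\<dots> = (if \<mu> i \<in> ?S then \<mu> i powr a *\<^sub>R x i else 0)"
      using fin by simp
    also have "\<dots> = \<mu> i powr a *\<^sub>R x i"
      using I i by (auto simp: spectrum_on_def eigenspace_def)
    finally show "(\<Sum>\<nu>\<in>?S. \<nu> powr a *\<^sub>R (if \<mu> i = \<nu> then x i else 0)) = \<mu> i powr a *\<^sub>R x i" .
  qed
  finally show ?thesis .
qed

section \<open>The estimate for an abstract divergence\<close>

text \<open>The comparison of the contributions of one eigenvalue \<open>\<mu>\<close>. With \<open>a = 1 - s\<close>, the lower bound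
  is \<open>\<beta> powr (2 * a) \<le> (\<mu> / (1 + \<mu>)) powr a\<close> multiplied by \<open>\<mu> powr s\<close>.\<close>

lemma scalar_bounds:
  fixes \<mu> \<beta> s :: real
  assumes "0 \<le> \<mu>" "0 < \<beta>" "0 \<le> s" "s \<le> 1" and b: "\<mu> > 0 \<Longrightarrow> \<beta>\<^sup>2 \<le> \<mu> / (1 + \<mu>)"
  shows "\<beta> powr (2 * (1 - s)) * \<mu> powr s \<le> (1 + \<mu>) powr (- (1 - s)) * \<mu>"
    and "(1 + \<mu>) powr (- (1 - s)) * \<mu> \<le> \<mu> powr s"
proof -
  have "\<beta> powr (2 * (1 - s)) * \<mu> powr s \<le> (1 + \<mu>) powr (- (1 - s)) * \<mu> \<and>
        (1 + \<mu>) powr (- (1 - s)) * \<mu> \<le> \<mu> powr s"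
  \<comment> \<open>For \<open>\<mu> = 0\<close> all terms vanish, since \<open>0 powr s = 0\<close> even for \<open>s = 0\<close>.\<close>
  proof (cases "\<mu> = 0")
    case False
    then have mu: "\<mu> > 0" using assms by simp
    have split: "\<mu> powr (1 - s) * \<mu> powr s = \<mu>"
      using mu by (simp add: powr_add[symmetric])
    have "\<beta> powr (2 * (1 - s)) = (\<beta>\<^sup>2) powr (1 - s)"
      using assms powr_powr[of \<beta> 2 "1 - s"] by simp
    also have "\<dots> \<le> (\<mu> / (1 + \<mu>)) powr (1 - s)"
      using assms b mu by (intro powr_mono2) auto
    also have "\<dots> = \<mu> powr (1 - s) * (1 + \<mu>) powr (- (1 - s))"
      using mu powr_minus_divide[of "1 + \<mu>" "1 - s"] by (simp add: powr_divide)
    finally have "\<beta> powr (2 * (1 - s)) * \<mu> powr s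
        \<le> \<mu> powr (1 - s) * (1 + \<mu>) powr (- (1 - s)) * \<mu> powr s"
      by (intro mult_right_mono) auto
    also have "\<dots> = (1 + \<mu>) powr (- (1 - s)) * \<mu>"
      by (subst (2) split[symmetric]) (simp only: mult_ac)
    finally have 1: "\<beta> powr (2 * (1 - s)) * \<mu> powr s \<le> (1 + \<mu>) powr (- (1 - s)) * \<mu>" .
    have "(1 + \<mu>) powr (- (1 - s)) * \<mu> \<le> \<mu> powr (- (1 - s)) * \<mu>"
      using assms mu by (intro mult_right_mono powr_mono2') auto
    also have "\<dots> = \<mu> powr (- (1 - s)) * \<mu> powr 1"
      using mu by simp
    also have "\<dots> = \<mu> powr s"
      by (simp only: powr_add[symmetric]) simp
    finally show ?thesis using 1 by blast
  qed simp
  then show "\<beta> powr (2 * (1 - s)) * \<mu> powr s \<le> (1 + \<mu>) powr (- (1 - s)) * \<mu>"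
    and "(1 + \<mu>) powr (- (1 - s)) * \<mu> \<le> \<mu> powr s" by auto
qed

text \<open>The estimate depends on the discretisation only through a linear map \<open>d\<close> from \<open>V\<close> to \<open>S\<close>
  that satisfies an inf-sup condition.\<close>

lemma inf_sup_fractional_bounds:
  fixes S :: "'x::real_inner set" and V :: "'y::real_inner set" and d :: "'y \<Rightarrow> 'x"
  defines "G \<equiv> \<lambda>u. riesz V (\<lambda>\<tau>. - (u \<bullet> d \<tau>))"
  defines "A \<equiv> \<lambda>u. riesz S (\<lambda>v. G u \<bullet> G v)"
  defines "L \<equiv> \<lambda>\<sigma>. riesz V (\<lambda>\<tau>. \<sigma> \<bullet> \<tau> + d \<sigma> \<bullet> d \<tau>)"
  assumes S: "finite_dim_subspace S" and V: "finite_dim_subspace V"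
    and d: "linear_on_subspace V d" "\<And>\<tau>. \<tau> \<in> V \<Longrightarrow> d \<tau> \<in> S"
    and s: "0 \<le> s" "s \<le> 1" and \<beta>: "\<beta> > 0"
    and inf_sup: "\<And>u. u \<in> S \<Longrightarrow> \<beta> * norm u \<le> (SUP \<tau>\<in>V - {0}. (u \<bullet> d \<tau>) / (L \<tau> \<bullet> \<tau>) powr (1/2))"
    and u: "u \<in> S"
  shows "\<beta> powr (2 * (1 - s)) * (frac_power S A s u \<bullet> u) \<le> frac_power V L (- (1 - s)) (G u) \<bullet> G u"
    and "frac_power V L (- (1 - s)) (G u) \<bullet> G u \<le> frac_power S A s u \<bullet> u"
proof -
  note DS = finite_dim_subspaceD[OF S] and DV = finite_dim_subspaceD[OF V]
  have dl: "\<And>x y. x \<in> V \<Longrightarrow> y \<in> V \<Longrightarrow> d (x + y) = d x + d y"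
    "\<And>c x. x \<in> V \<Longrightarrow> d (c *\<^sub>R x) = c *\<^sub>R d x"
    using d by (auto simp: linear_on_subspace_def)
  have G: "G u \<in> V" "\<tau> \<in> V \<Longrightarrow> G u \<bullet> \<tau> = - (u \<bullet> d \<tau>)" for u \<tau>
    unfolding G_def
    by (intro riesz_representation V; simp add: linear_on_subspace_def dl inner_add_right)+
  have Glin: "G (x + y) = G x + G y" "G (c *\<^sub>R x) = c *\<^sub>R G x" for x y c
    by (rule eq_if_inner_eq[OF V]; simp add: G DV inner_add_left)+
  have A: "A u \<in> S" "v \<in> S \<Longrightarrow> A u \<bullet> v = G u \<bullet> G v" for u v
    unfolding A_def
    by (intro riesz_representation S; simp add: linear_on_subspace_def Glin inner_add_right)+
  have L: "L \<sigma> \<in> V" "\<tau> \<in> V \<Longrightarrow> L \<sigma> \<bullet> \<tau> = \<sigma> \<bullet> \<tau> + d \<sigma> \<bullet> d \<tau>" for \<sigma> \<tau>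
    unfolding L_def
    by (intro riesz_representation V; simp add: linear_on_subspace_def dl inner_add_right algebra_simps)+
  have symA: "symmetric_operator S A"
    unfolding symmetric_operator_def using A by (metis inner_commute)
  have symL: "symmetric_operator V L"
    unfolding symmetric_operator_def using L by (metis inner_commute)
  obtain E \<mu> where E: "finite E" "orthonormal E" "span E = S" "\<And>e. e \<in> E \<Longrightarrow> A e = \<mu> e *\<^sub>R e"
    using spectral_theorem[OF S symA] by metis
  have ES: "e \<in> S" if "e \<in> E" for e using that E(3) span_base by blast
  have GG: "G e \<bullet> G e' = (if e = e' then \<mu> e else 0)" if "e \<in> E" "e' \<in> E" for e e'
    using A(2)[OF ES[OF that(2)], of e] E(2,4) that by (auto simp: orthonormal_def)
  have mu0: "0 \<le> \<mu> e" if "e \<in> E" for e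
    using GG[OF that that] by (metis inner_ge_zero)
  \<comment> \<open>This is \<open>A = - d G\<close>, for which it matters that \<open>d\<close> takes its values in \<open>S\<close>.\<close>
  have dG: "d (G e) = - \<mu> e *\<^sub>R e" if e: "e \<in> E" for e
  proof (rule eq_if_inner_eq[OF S])
    fix v assume v: "v \<in> S"
    have "d (G e) \<bullet> v = - (G v \<bullet> G e)"
      using G by (simp add: inner_commute)
    also have "\<dots> = - (A e \<bullet> v)"
      using A(2)[OF v, of e] by (simp add: inner_commute)
    finally show "d (G e) \<bullet> v = - \<mu> e *\<^sub>R e \<bullet> v"
      using E(4)[OF e] by simp
  qed (use d G DS ES e in auto)
  have LG: "L (G e) = (1 + \<mu> e) *\<^sub>R G e" if e: "e \<in> E" for e
  proof (rule eq_if_inner_eq[OF V])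
    fix v assume "v \<in> V"
    then show "L (G e) \<bullet> v = (1 + \<mu> e) *\<^sub>R G e \<bullet> v"
      using L(2) dG[OF e] G by (simp add: algebra_simps)
  qed (use G L DV in auto)
  have bound: "\<beta>\<^sup>2 \<le> \<mu> e / (1 + \<mu> e)" if e: "e \<in> E" and pos: "\<mu> e > 0" for e
  proof -
    \<comment> \<open>The supremum is taken over a nonempty set because \<open>\<parallel>G e\<parallel>\<^sup>2 = \<mu> e > 0\<close>.\<close>
    have "G e \<in> V - {0}" using GG[OF e e] G(1)[of e] pos
      by (metis DiffI inner_zero_left less_irrefl singletonD)
    then have ne: "V - {0} \<noteq> {}" by blast
    have "\<beta> * norm e \<le> (SUP \<tau>\<in>V - {0}. (e \<bullet> d \<tau>) / (L \<tau> \<bullet> \<tau>) powr (1/2))"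
      using inf_sup ES e by blast
    also have "\<dots> \<le> sqrt (\<mu> e / (1 + \<mu> e))"
    proof (rule cSUP_least[OF ne])
      fix \<tau> assume \<tau>: "\<tau> \<in> V - {0}"
      let ?n = "L \<tau> \<bullet> \<tau>"
      \<comment> \<open>The inner product of \<open>\<Lambda>\<close> is that of the graph of \<open>d\<close> in the product space.\<close>
      have n: "?n = norm (\<tau>, d \<tau>) ^ 2"
        using \<tau> L by (simp add: dot_square_norm[symmetric] inner_prod_def)
      have np: "?n > 0"
        using n \<tau> by (simp add: zero_prod_def)
      have "(1 + \<mu> e) * (e \<bullet> d \<tau>) = - (L (G e) \<bullet> \<tau>)"
        using LG[OF e] G(2)[of \<tau> e] \<tau> by simp
      also have "\<dots> = - ((G e, d (G e)) \<bullet> (\<tau>, d \<tau>))"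
        using L \<tau> by (simp add: inner_prod_def)
      also have "\<dots> \<le> norm (G e, d (G e)) * norm (\<tau>, d \<tau>)"
        using Cauchy_Schwarz_ineq2[of "(G e, d (G e))" "(\<tau>, d \<tau>)"] by linarith
      also have "norm (\<tau>, d \<tau>) = sqrt ?n" using n by simp
      also have "norm (G e, d (G e)) = sqrt ((1 + \<mu> e) * \<mu> e)"
      proof -
        have "L (G e) \<bullet> G e = (1 + \<mu> e) * \<mu> e" using LG[OF e] GG[OF e e] by simp
        moreover have "L (G e) \<bullet> G e = (G e, d (G e)) \<bullet> (G e, d (G e))"
          using L G by (simp add: inner_prod_def)
        ultimately show ?thesis by (simp add: norm_eq_sqrt_inner)
      qed
      finally have "(1 + \<mu> e) * (e \<bullet> d \<tau>) \<le> sqrt ((1 + \<mu> e) * \<mu> e) * sqrt ?n" .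
      then have "(e \<bullet> d \<tau>) \<le> sqrt ((1 + \<mu> e) * \<mu> e) * sqrt ?n / (1 + \<mu> e)"
        using pos by (simp add: pos_le_divide_eq mult.commute)
      also have "sqrt ((1 + \<mu> e) * \<mu> e) * sqrt ?n / (1 + \<mu> e) = sqrt (\<mu> e / (1 + \<mu> e)) * sqrt ?n"
      proof -
        have "sqrt ((1 + \<mu> e) * \<mu> e) = (1 + \<mu> e) * sqrt (\<mu> e / (1 + \<mu> e))"
          using pos by (intro real_sqrt_unique)
            (auto simp: power_mult_distrib power2_eq_square[of "1 + \<mu> e"])
        then show ?thesis using pos by simp
      qed
      finally show "(e \<bullet> d \<tau>) / ?n powr (1/2) \<le> sqrt (\<mu> e / (1 + \<mu> e))"
        using np by (simp add: powr_half_sqrt pos_divide_le_eq)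
    qed
    finally have "\<beta> \<le> sqrt (\<mu> e / (1 + \<mu> e))"
      using E(2) e by (simp add: norm_eq_sqrt_inner orthonormal_def)
    then have "\<beta>\<^sup>2 \<le> (sqrt (\<mu> e / (1 + \<mu> e)))\<^sup>2"
      using \<beta> by (intro power_mono) auto
    then show ?thesis using pos by simp
  qed
  define c where "c = (\<lambda>e. u \<bullet> e)"
  have u_eq: "u = (\<Sum>e\<in>E. c e *\<^sub>R e)"
    using orthonormal_expansion[OF E(1,2), of u] E(3) u by (simp add: c_def)
  have Gu: "G u = (\<Sum>e\<in>E. c e *\<^sub>R G e)"
    using linear_on_subspace_expansion[of S G E u] E u Glin
    by (simp add: linear_on_subspace_def c_def)
  have cross: "(\<Sum>e\<in>E. a e *\<^sub>R f e) \<bullet> (\<Sum>e\<in>E. c e *\<^sub>R f e) = (\<Sum>e\<in>E. a e * c e * m e)"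
    if "\<And>e e'. e \<in> E \<Longrightarrow> e' \<in> E \<Longrightarrow> f e \<bullet> f e' = (if e = e' then m e else 0)" for a m and f :: "'x \<Rightarrow> 'z::real_inner"
  proof -
    have "(\<Sum>e\<in>E. a e *\<^sub>R f e) \<bullet> (\<Sum>e\<in>E. c e *\<^sub>R f e) = (\<Sum>e\<in>E. \<Sum>e'\<in>E. if e = e' then a e * c e * m e else 0)"
      unfolding inner_sum_left inner_sum_right using that by (auto intro!: sum.cong)
    then show ?thesis using E(1) by simp
  qed
  have "frac_power S A s u = (\<Sum>e\<in>E. \<mu> e powr s *\<^sub>R (c e *\<^sub>R e))"
    unfolding u_eq
    by (rule frac_power_sum_eigenvectors[OF S symA E(1)])
       (use E ES symmetric_operator_linear[OF S symA] DS in \<open>auto simp: linear_on_subspace_def\<close>)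
  then have As: "frac_power S A s u \<bullet> u = (\<Sum>e\<in>E. (c e)\<^sup>2 * \<mu> e powr s)"
    using cross[of "\<lambda>e. e" "\<lambda>_. 1" "\<lambda>e. \<mu> e powr s * c e"] E(2)
    by (subst (2) u_eq) (simp add: orthonormal_def power2_eq_square mult_ac)
  have "frac_power V L (- (1 - s)) (G u) = (\<Sum>e\<in>E. (1 + \<mu> e) powr (- (1 - s)) *\<^sub>R (c e *\<^sub>R G e))"
    unfolding Gu
    by (rule frac_power_sum_eigenvectors[OF V symL E(1)])
       (use E G LG symmetric_operator_linear[OF V symL] DV in \<open>auto simp: linear_on_subspace_def\<close>)
  then have Ls: "frac_power V L (- (1 - s)) (G u) \<bullet> G u = (\<Sum>e\<in>E. (c e)\<^sup>2 * ((1 + \<mu> e) powr (- (1 - s)) * \<mu> e))"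
    using cross[of G \<mu> "\<lambda>e. (1 + \<mu> e) powr (- (1 - s)) * c e"] GG
    by (subst (2) Gu) (simp add: power2_eq_square mult_ac)
  note sb = scalar_bounds[OF mu0 \<beta> s bound]
  show "\<beta> powr (2 * (1 - s)) * (frac_power S A s u \<bullet> u) \<le> frac_power V L (- (1 - s)) (G u) \<bullet> G u"
    unfolding As Ls sum_distrib_left
    by (rule sum_mono) (use sb(1) in \<open>auto simp: mult.left_commute intro!: mult_left_mono\<close>)
  show "frac_power V L (- (1 - s)) (G u) \<bullet> G u \<le> frac_power S A s u \<bullet> u"
    unfolding As Ls by (intro sum_mono mult_left_mono sb(2)) auto
qed

section \<open>Functions with continuous gradient\<close>

definition C1_gradient :: "('a::euclidean_space \<Rightarrow> real) \<Rightarrow> ('a \<Rightarrow> 'a) \<Rightarrow> bool" where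
  "C1_gradient f f' \<longleftrightarrow> (\<forall>x. GDERIV f x :> f' x) \<and> continuous_on UNIV f'"

lemma C1_gradient_continuous:
  assumes "C1_gradient f f'" shows "continuous_on S f"
proof (rule continuous_at_imp_continuous_on, rule ballI)
  show "isCont f x" for x
    by (rule has_derivative_continuous) (use assms in \<open>auto simp: C1_gradient_def gderiv_def\<close>)
qed

lemma C1_gradient_continuous':
  assumes "C1_gradient f f'" shows "continuous_on S f'"
  using assms continuous_on_subset by (auto simp: C1_gradient_def)

lemma C1_gradient_const: "C1_gradient (\<lambda>x. c) (\<lambda>x. 0)"
  by (simp add: C1_gradient_def GDERIV_const)

lemma C1_gradient_add:
  assumes "C1_gradient f f'" "C1_gradient g g'"
  shows "C1_gradient (\<lambda>x. f x + g x) (\<lambda>x. f' x + g' x)"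
  using assms by (auto simp: C1_gradient_def intro!: GDERIV_add continuous_intros)

lemma C1_gradient_mult:
  assumes "C1_gradient f f'" "C1_gradient g g'"
  shows "C1_gradient (\<lambda>x. f x * g x) (\<lambda>x. f x *\<^sub>R g' x + g x *\<^sub>R f' x)"
  using C1_gradient_continuous[OF assms(1), of UNIV] C1_gradient_continuous[OF assms(2), of UNIV] assms
  by (auto simp: C1_gradient_def intro!: GDERIV_mult continuous_intros)

lemma C1_gradient_sum:
  assumes "\<And>i. i \<in> I \<Longrightarrow> C1_gradient (f i) (f' i)"
  shows "C1_gradient (\<lambda>x. \<Sum>i\<in>I. f i x) (\<lambda>x. \<Sum>i\<in>I. f' i x)"
proof (cases "finite I")
  case True
  then show ?thesis using assms
    by (induction I) (auto simp: C1_gradient_const intro!: C1_gradient_add)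
qed (simp add: C1_gradient_const)

lemma C1_gradient_inner: "C1_gradient (\<lambda>x. x \<bullet> b) (\<lambda>x. b)"
  by (auto simp: C1_gradient_def gderiv_def intro!: derivative_eq_intros)

lemma C1_gradient_compose:
  assumes "C1_gradient f f'" "\<And>t. (k has_real_derivative k' t) (at t)" "continuous_on UNIV k'"
  shows "C1_gradient (\<lambda>x. k (f x)) (\<lambda>x. k' (f x) *\<^sub>R f' x)"
proof -
  have "continuous_on UNIV (\<lambda>x. k' (f x))"
    using continuous_on_compose2[OF assms(3) C1_gradient_continuous[OF assms(1)]] by simp
  then have "continuous_on UNIV (\<lambda>x. k' (f x) *\<^sub>R f' x)"
    using C1_gradient_continuous'[OF assms(1)] by (rule continuous_on_scaleR)
  moreover have "GDERIV (\<lambda>x. k (f x)) x :> k' (f x) *\<^sub>R f' x" for x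
    by (rule GDERIV_DERIV_compose[OF _ assms(2)]) (use assms(1) in \<open>simp add: C1_gradient_def\<close>)
  ultimately show ?thesis by (simp add: C1_gradient_def)
qed

text \<open>A nonnegative function of class $C^1$ that vanishes exactly on the half-line \<open>t \<le> 0\<close>; the
  cutoff functions below are built from it.\<close>

definition sq_pos :: "real \<Rightarrow> real" where
  "sq_pos t = (max 0 t)\<^sup>2"

lemma sq_pos_deriv: "(sq_pos has_real_derivative 2 * max 0 t) (at t)"
proof -
  consider "t > 0" | "t < 0" | "t = 0" by linarith
  then show ?thesis
  proof cases
    case 1
    have "((\<lambda>t. t\<^sup>2) has_real_derivative 2 * max 0 t) (at t)"
      using 1 by (auto intro!: derivative_eq_intros)
    then show ?thesis
      by (rule has_field_derivative_transform_within_open[where S = "{0<..}"])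
        (use 1 in \<open>auto simp: sq_pos_def\<close>)
  next
    case 2
    have "((\<lambda>t. 0) has_real_derivative 2 * max 0 t) (at t)"
      using 2 by simp
    then show ?thesis
      by (rule has_field_derivative_transform_within_open[where S = "{..<0}"])
        (use 2 in \<open>auto simp: sq_pos_def\<close>)
  next
    case 3
    have "norm (sq_pos h / h) \<le> norm h" for h
      by (cases "h > 0") (auto simp: sq_pos_def power2_eq_square)
    then have "((\<lambda>h. sq_pos h / h) \<longlongrightarrow> 0) (at 0)"
      by (intro Lim_null_comparison[OF _ tendsto_norm_zero[OF tendsto_ident_at]] always_eventually allI)
    then show ?thesis
      using 3 by (simp add: DERIV_def sq_pos_def)
  qed
qed

lemma C1_gradient_sq_pos:
  assumes "C1_gradient f f'"
  shows "C1_gradient (\<lambda>x. sq_pos (f x)) (\<lambda>x. (2 * max 0 (f x)) *\<^sub>R f' x)"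
  using assms sq_pos_deriv by (rule C1_gradient_compose) (intro continuous_intros)

text \<open>Cover \<open>K\<close> by finitely many balls with closures in \<open>U\<close>. The sum \<open>w\<close> of the functions \<open>sq_pos
  (\<rho>\<^sup>2 - \<bar>x - c\<bar>\<^sup>2)\<close> over these balls is positive on \<open>K\<close>, hence at least some \<open>m > 0\<close> there, and
  vanishes outside the balls. The composition \<open>1 - sq_pos (1 - w / m)\<close> is \<open>0\<close> where \<open>w = 0\<close> and
  equals \<open>1\<close> where \<open>w \<ge> m\<close>, so applying \<open>sq_pos\<close> once more gives the cutoff function.\<close>

lemma smooth_cutoff:
  fixes K U :: "'a::euclidean_space set"
  assumes K: "compact K" and U: "open U" "K \<subseteq> U"
  obtains \<phi> \<phi>' where "test_function U \<phi> \<phi>'" "\<And>x. 0 \<le> \<phi> x" "\<And>x. \<phi> x \<le> 1" "\<And>x. x \<in> K \<Longrightarrow> \<phi> x = 1"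
proof -
  obtain \<rho> where \<rho>: "\<And>x. x \<in> K \<Longrightarrow> \<rho> x > 0" "\<And>x. x \<in> K \<Longrightarrow> cball x (\<rho> x) \<subseteq> U"
    using U open_contains_cball by (metis subsetD)
  obtain D where D: "D \<subseteq> K" "finite D" "K \<subseteq> (\<Union>c\<in>D. ball c (\<rho> c))"
    using compactE_image[OF K, of K "\<lambda>c. ball c (\<rho> c)"] \<rho>
    by (metis (no_types, lifting) UN_I centre_in_ball open_ball subsetI)
  \<comment> \<open>The shape of the right-hand side matches the rules for sums, products and linear functionals.\<close>
  define b where "b = (\<lambda>c x. (\<rho> c)\<^sup>2 + (-1) * ((x \<bullet> x) + (x \<bullet> (-2 *\<^sub>R c) + c \<bullet> c)))"
  have b_eq: "b c x = (\<rho> c)\<^sup>2 - (dist c x)\<^sup>2" for c x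
    by (simp add: b_def dist_norm power2_norm_eq_inner inner_diff_left inner_diff_right inner_commute)
  have xx: "C1_gradient (\<lambda>x::'a. x \<bullet> x) (\<lambda>x. 2 *\<^sub>R x)"
    by (auto simp: C1_gradient_def gderiv_def inner_commute intro!: derivative_eq_intros continuous_intros)
  have "\<exists>b'. C1_gradient (b c) b'" for c
    unfolding b_def
    by (rule exI, (rule C1_gradient_add C1_gradient_mult xx C1_gradient_inner C1_gradient_const)+)
  then obtain b' where b': "\<And>c. C1_gradient (b c) (b' c)" by metis
  define w where "w = (\<lambda>x. \<Sum>c\<in>D. sq_pos (b c x))"
  have "\<exists>w'. C1_gradient w w'"
    unfolding w_def by (rule exI, (rule C1_gradient_sum C1_gradient_sq_pos b')+)
  then obtain w' where w': "C1_gradient w w'" by blast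
  have w0: "0 \<le> w x" for x
    by (auto simp: w_def sq_pos_def intro: sum_nonneg)
  have wpos: "w x > 0" if "x \<in> K" for x
  proof -
    from D that obtain c where c: "c \<in> D" "dist c x < \<rho> c" by auto
    then have "(dist c x)\<^sup>2 < (\<rho> c)\<^sup>2"
      by (intro power_strict_mono) auto
    then have "sq_pos (b c x) > 0" by (simp add: b_eq sq_pos_def)
    then show ?thesis unfolding w_def
      using c D by (intro sum_pos2[of D c]) (auto simp: sq_pos_def)
  qed
  obtain m where m: "m > 0" "\<And>x. x \<in> K \<Longrightarrow> m \<le> w x"
  proof (cases "K = {}")
    case False
    then obtain x where "x \<in> K" "\<forall>y\<in>K. w x \<le> w y"
      using continuous_attains_inf[OF K _ C1_gradient_continuous[OF w']] by blast
    then show ?thesis using that[of "w x"] wpos by blast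
  qed (use that[of 1] in auto)
  define \<phi> where "\<phi> = (\<lambda>x. sq_pos (1 + (-1) * sq_pos (1 + (- 1 / m) * w x)))"
  have "\<exists>\<phi>'. C1_gradient \<phi> \<phi>'"
    unfolding \<phi>_def
    by (rule exI, (rule C1_gradient_sq_pos C1_gradient_add C1_gradient_mult w' C1_gradient_const)+)
  then obtain \<phi>' where \<phi>': "C1_gradient \<phi> \<phi>'" by blast
  let ?s = "\<lambda>x. sq_pos (1 + (- 1 / m) * w x)"
  have s: "0 \<le> ?s x" "?s x \<le> 1" for x
  proof -
    show "0 \<le> ?s x" by (simp add: sq_pos_def)
    have "max 0 (1 + (- 1 / m) * w x) \<le> 1" using w0[of x] m by simp
    then show "?s x \<le> 1" unfolding sq_pos_def by (intro power_le_one) auto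
  qed
  have range: "0 \<le> \<phi> x" "\<phi> x \<le> 1" for x
    using s[of x] unfolding \<phi>_def sq_pos_def[of "1 + (-1) * ?s x"] by (auto intro: power_le_one)
  have one: "\<phi> x = 1" if "x \<in> K" for x
  proof -
    have "1 + (- 1 / m) * w x \<le> 0" using m that by (simp add: field_simps)
    then have "?s x = 0" by (simp add: sq_pos_def)
    then show ?thesis by (simp add: \<phi>_def sq_pos_def)
  qed
  have supp: "{x. \<phi> x \<noteq> 0} \<subseteq> (\<Union>c\<in>D. cball c (\<rho> c))"
  proof (rule subsetI, rule ccontr)
    fix x assume x: "x \<in> {x. \<phi> x \<noteq> 0}" "x \<notin> (\<Union>c\<in>D. cball c (\<rho> c))"
    have "sq_pos (b c x) = 0" if "c \<in> D" for c
    proof -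
      have "\<rho> c < dist c x" "0 < \<rho> c" using that x D \<rho> by auto
      then have "(\<rho> c)\<^sup>2 < (dist c x)\<^sup>2" by (intro power_strict_mono) auto
      then show ?thesis by (simp add: b_eq sq_pos_def)
    qed
    then have "w x = 0" by (simp add: w_def)
    then show False using x by (simp add: \<phi>_def sq_pos_def)
  qed
  have cpt: "compact (\<Union>c\<in>D. cball c (\<rho> c))"
    using D by (intro compact_UN) auto
  have cl: "closure {x. \<phi> x \<noteq> 0} \<subseteq> (\<Union>c\<in>D. cball c (\<rho> c))"
    using supp cpt by (intro closure_minimal compact_imp_closed)
  have "compact (closure {x. \<phi> x \<noteq> 0})"
    using cl cpt
    by (metis closed_closure closure_mono closure_closed compact_Int_closed compact_imp_closed inf.absorb_iff2)
  moreover have "(\<Union>c\<in>D. cball c (\<rho> c)) \<subseteq> U"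
    using \<rho>(2) D by blast
  ultimately have "test_function U \<phi> \<phi>'"
    using \<phi>' cl unfolding test_function_def C1_gradient_def by blast
  then show thesis using that range one by blast
qed

lemma continuous_imp_lebesgue_measurable:
  fixes f :: "'a::euclidean_space \<Rightarrow> 'b::topological_space"
  assumes "continuous_on UNIV f"
  shows "f \<in> borel_measurable lebesgue"
  by (rule measurable_completion) (simp add: borel_measurable_continuous_onI[OF assms])

section \<open>The fundamental lemma of the calculus of variations\<close>

definition locally_integrable :: "('a::euclidean_space \<Rightarrow> real) \<Rightarrow> bool" where
  "locally_integrable h \<longleftrightarrow>
     h \<in> borel_measurable lebesgue \<and> (\<forall>K. compact K \<longrightarrow> integrable lebesgue (\<lambda>x. indicator K x * h x))"

text \<open>Cutoff functions of \<open>K\<close> supported in shrinking neighbourhoods converge to the indicator of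
  \<open>K\<close>.\<close>

lemma fundamental_lemma_compact:
  fixes h :: "'a::euclidean_space \<Rightarrow> real"
  assumes h: "locally_integrable h" and U: "open U"
    and z: "\<And>\<phi> \<phi>'. test_function U \<phi> \<phi>' \<Longrightarrow> (LINT x|lebesgue. h x * \<phi> x) = 0"
    and K: "compact K" "K \<subseteq> U"
  shows "(LINT x|lebesgue. indicator K x * h x) = 0"
proof (cases "K = {}")
  case False
  define N where "N = (\<lambda>n. U \<inter> {x. infdist x K < 1 / real (Suc n)})"
  have "\<exists>\<phi> \<phi>'. test_function (N n) \<phi> \<phi>' \<and> (\<forall>x. 0 \<le> \<phi> x \<and> \<phi> x \<le> 1) \<and> (\<forall>x\<in>K. \<phi> x = 1)" for n
  proof -
    have "open (N n)"
      unfolding N_def using U by (intro open_Int open_Collect_less continuous_intros)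
    moreover have "K \<subseteq> N n" using K by (auto simp: N_def)
    ultimately show ?thesis using smooth_cutoff[OF K(1)] by metis
  qed
  then obtain \<phi> \<phi>' where \<phi>: "\<And>n. test_function (N n) (\<phi> n) (\<phi>' n)"
    "\<And>n x. 0 \<le> \<phi> n x" "\<And>n x. \<phi> n x \<le> 1" "\<And>n x. x \<in> K \<Longrightarrow> \<phi> n x = 1"
    by metis
  have out: "\<phi> n x = 0" if "x \<notin> N n" for n x
    using \<phi>(1)[of n] closure_subset[of "{x. \<phi> n x \<noteq> 0}"] that by (auto simp: test_function_def)
  define C where "C = {x. infdist x K \<le> 1}"
  have C: "compact C"
    unfolding C_def using K False by (intro compact_infdist_le) auto
  have NC: "N n \<subseteq> C" for n
  proof
    fix x assume "x \<in> N n"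
    then have "infdist x K < 1 / real (Suc n)" by (simp add: N_def)
    also have "\<dots> \<le> 1" by simp
    finally show "x \<in> C" by (simp add: C_def)
  qed
  have hm: "h \<in> borel_measurable lebesgue"
    and hC: "integrable lebesgue (\<lambda>x. indicator C x * h x)"
    using h C by (auto simp: locally_integrable_def)
  have Km: "K \<in> sets lebesgue"
    using K by (simp add: compact_imp_closed)
  have "(\<lambda>n. LINT x|lebesgue. h x * \<phi> n x) \<longlonglongrightarrow> (LINT x|lebesgue. indicator K x * h x)"
  proof (rule integral_dominated_convergence)
    show "(\<lambda>x. indicator K x * h x) \<in> borel_measurable lebesgue"
      using hm Km by measurable
    show "(\<lambda>x. h x * \<phi> n x) \<in> borel_measurable lebesgue" for n
    proof -
      have "C1_gradient (\<phi> n) (\<phi>' n)" using \<phi>(1) by (simp add: test_function_def C1_gradient_def)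
      then have "continuous_on UNIV (\<phi> n)" by (rule C1_gradient_continuous)
      then have "\<phi> n \<in> borel_measurable lebesgue"
        by (rule continuous_imp_lebesgue_measurable)
      then show ?thesis using hm by measurable
    qed
    show "integrable lebesgue (\<lambda>x. \<bar>indicator C x * h x\<bar>)"
      using hC by (rule integrable_abs)
    show "AE x in lebesgue. norm (h x * \<phi> n x) \<le> \<bar>indicator C x * h x\<bar>" for n
    proof (rule AE_I2)
      fix x show "norm (h x * \<phi> n x) \<le> \<bar>indicator C x * h x\<bar>"
      proof (cases "x \<in> C")
        case True
        then show ?thesis using \<phi>(2,3)[of n x] by (simp add: abs_mult mult_left_le)
      next
        case False
        then have "\<phi> n x = 0" using NC[of n] out[of x n] by blast
        then show ?thesis by simp
      qed
    qed
    show "AE x in lebesgue. (\<lambda>n. h x * \<phi> n x) \<longlonglongrightarrow> indicator K x * h x"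
    proof (rule AE_I2)
      fix x
      show "(\<lambda>n. h x * \<phi> n x) \<longlonglongrightarrow> indicator K x * h x"
      proof (cases "x \<in> K")
        case True
        then show ?thesis using \<phi>(4) by simp
      next
        case False
        have "infdist x K > 0"
          using False K \<open>K \<noteq> {}\<close> infdist_pos_not_in_closed compact_imp_closed by blast
        then obtain n0 where n0: "1 / real (Suc n0) < infdist x K"
          using nat_approx_posE by blast
        have "\<phi> n x = 0" if "n \<ge> n0" for n
        proof (rule out)
          have "1 / real (Suc n) \<le> 1 / real (Suc n0)"
            using that by (intro divide_left_mono) auto
          then show "x \<notin> N n" using n0 by (auto simp: N_def)
        qed
        then have "eventually (\<lambda>n. h x * \<phi> n x = 0) sequentially"
          by (auto simp: eventually_sequentially)
        then show ?thesis using False by (simp add: tendsto_eventually)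
      qed
    qed
  qed
  moreover have "(LINT x|lebesgue. h x * \<phi> n x) = 0" for n
    by (rule z[of _ "\<phi>' n"]) (use \<phi>(1)[of n] in \<open>auto simp: test_function_def N_def\<close>)
  ultimately show ?thesis by (simp add: LIMSEQ_const_iff)
qed simp

text \<open>By inner regularity, the set where \<open>h\<close> is positive is, up to a null set, a countable union
  of compact sets. The integral of \<open>h\<close> over each of them is zero, so each is null; the same holds
  for \<open>-h\<close>.\<close>

lemma fundamental_lemma:
  fixes h :: "'a::euclidean_space \<Rightarrow> real"
  assumes h: "locally_integrable h" and U: "open U"
    and z: "\<And>\<phi> \<phi>'. test_function U \<phi> \<phi>' \<Longrightarrow> (LINT x|lebesgue. h x * \<phi> x) = 0"
  shows "AE x in lebesgue. x \<in> U \<longrightarrow> h x = 0"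
proof -
  have *: "AE x in lebesgue. x \<in> U \<longrightarrow> \<not> c * h x > 0" for c :: real
  proof -
    have hm: "h \<in> borel_measurable lebesgue" using h by (simp add: locally_integrable_def)
    have Um: "U \<in> sets lebesgue" using U by auto
    define P where "P = U \<inter> {x. c * h x > 0}"
    have "{x \<in> space lebesgue. c * h x > 0} \<in> sets lebesgue"
      using hm by measurable
    then have Pm: "P \<in> sets lebesgue" using Um by (simp add: P_def)
    obtain N C where NC: "negligible N" "\<And>n::nat. compact (C n)" "P = (\<Union>n. C n) \<union> N"
      by (rule lebesgue_regular_inner[OF Pm]) (rule that)
    have "AE x in lebesgue. x \<notin> C n" for n
    proof -
      have CP: "C n \<subseteq> P" using NC(3) by blast
      have i: "integrable lebesgue (\<lambda>x. indicator (C n) x * h x)"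
        using h NC(2) by (simp add: locally_integrable_def)
      have "(LINT x|lebesgue. indicator (C n) x * h x) = 0"
        by (rule fundamental_lemma_compact[OF h U z NC(2)]) (use CP in \<open>auto simp: P_def\<close>)
      then have "(LINT x|lebesgue. c * (indicator (C n) x * h x)) = 0"
        by simp
      moreover have "AE x in lebesgue. 0 \<le> c * (indicator (C n) x * h x)"
        using CP by (intro AE_I2) (auto simp: indicator_def P_def)
      moreover have "integrable lebesgue (\<lambda>x. c * (indicator (C n) x * h x))"
        using i by (rule integrable_mult_right)
      ultimately have "AE x in lebesgue. c * (indicator (C n) x * h x) = 0"
        using integral_nonneg_eq_0_iff_AE by blast
      then show ?thesis
      proof eventually_elim
        case (elim x)
        show ?case
        proof
          assume "x \<in> C n"
          moreover from this have "c * h x > 0" using CP by (auto simp: P_def)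
          ultimately show False using elim by auto
        qed
      qed
    qed
    then have "AE x in lebesgue. \<forall>n. x \<notin> C n"
      by (simp add: AE_all_countable)
    moreover have "AE x in lebesgue. x \<notin> N"
      using NC(1) by (intro AE_not_in) (simp add: negligible_iff_null_sets)
    ultimately have "AE x in lebesgue. x \<notin> P"
      by eventually_elim (use NC(3) in blast)
    then show ?thesis by (rule AE_mp) (auto simp: P_def)
  qed
  from *[of 1] *[of "-1"] show ?thesis
    by eventually_elim force
qed

section \<open>Integration by parts\<close>

text \<open>The difference quotients of \<open>f\<close> in the direction \<open>e\<close> have integral zero by translation
  invariance of Lebesgue measure, and they converge boundedly to the directional derivative.\<close>

lemma integral_directional_derivative_zero:
  fixes f :: "'a::euclidean_space \<Rightarrow> real"
  assumes f: "C1_gradient f f'" and C: "compact C" "\<And>x. x \<notin> C \<Longrightarrow> f x = 0"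
  shows "integrable lebesgue (\<lambda>x. f' x \<bullet> e)" "(LINT x|lebesgue. f' x \<bullet> e) = 0"
proof -
  obtain R where R: "C \<subseteq> cball 0 R"
    using compact_imp_bounded[OF C(1)] by (auto simp: bounded_iff subset_iff)
  define t where "t = (\<lambda>n. 1 / real (Suc n))"
  have t: "0 < t n" "t n \<le> 1" for n by (auto simp: t_def)
  define Q where "Q = (\<lambda>n x. (f (t n *\<^sub>R e + x) - f x) / t n)"
  have cf: "continuous_on UNIV f" using f by (rule C1_gradient_continuous)
  have fm: "f \<in> borel_measurable borel"
    using cf by (rule borel_measurable_continuous_onI)
  have f'm: "(\<lambda>x. f' x \<bullet> e) \<in> borel_measurable borel"
    using C1_gradient_continuous'[OF f]
    by (intro borel_measurable_continuous_onI continuous_intros) 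
  have fi: "integrable lborel f"
  proof -
    have "(\<lambda>x. indicator C x *\<^sub>R f x) = f" using C(2) by (force simp: indicator_def)
    then show ?thesis
      using borel_integrable_compact[OF C(1), of f] continuous_on_subset[OF cf] by auto
  qed
  have fsm: "(\<lambda>x. f (c + x)) \<in> borel_measurable borel" for c
    using fm by measurable
  have shift: "integrable lborel (\<lambda>x. f (c + x))" "(LINT x|lborel. f (c + x)) = (LINT x|lborel. f x)" for c
  proof -
    have "integrable (distr lborel borel ((+) c)) f" using fi by (simp add: lborel_distr_plus)
    then show "integrable lborel (\<lambda>x. f (c + x))"
      by (subst (asm) integrable_distr_eq) (use fm in auto)
    have "(LINT x|distr lborel borel ((+) c). f x) = (LINT x|lborel. f (c + x))"
      by (rule integral_distr) (use fm in auto)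
    then show "(LINT x|lborel. f (c + x)) = (LINT x|lborel. f x)" by (simp add: lborel_distr_plus)
  qed
  have Q0: "(LINT x|lborel. Q n x) = 0" for n
    using shift[of "t n *\<^sub>R e"] fi by (simp add: Q_def)
  have path: "((\<lambda>s. f (s *\<^sub>R e + x)) has_real_derivative f' (s *\<^sub>R e + x) \<bullet> e) (at s)" for s x
  proof -
    have 1: "FDERIV f (s *\<^sub>R e + x) :> (\<lambda>h. h \<bullet> f' (s *\<^sub>R e + x))"
      using f by (simp add: C1_gradient_def gderiv_def)
    have 2: "((\<lambda>s. s *\<^sub>R e + x) has_derivative (\<lambda>r. r *\<^sub>R e)) (at s)"
      by (auto intro!: derivative_eq_intros)
    have "(\<lambda>r. (r *\<^sub>R e) \<bullet> f' (s *\<^sub>R e + x)) = (*) (f' (s *\<^sub>R e + x) \<bullet> e)"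
      by (auto simp: inner_commute)
    with has_derivative_compose[OF 2 1] show ?thesis
      by (simp only: has_field_derivative_def)
  qed
  \<comment> \<open>For \<open>0 < t \<le> 1\<close> the difference quotients vanish outside \<open>B\<close>, and the segment from a point \<open>x\<close>
    of \<open>B\<close> to \<open>x + t e\<close> lies in \<open>R2\<close>.\<close>
  define R2 where "R2 = cball (0::'a) (R + 2 * norm e)"
  have "compact ((\<lambda>x. f' x \<bullet> e) ` R2)"
    unfolding R2_def using C1_gradient_continuous'[OF f]
    by (intro compact_continuous_image continuous_intros) auto
  then obtain M where M: "\<And>x. x \<in> R2 \<Longrightarrow> \<bar>f' x \<bullet> e\<bar> \<le> M"
    using compact_imp_bounded bounded_real by (metis (no_types, lifting) imageI)
  define B where "B = cball (0::'a) (R + norm e)"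
  have Qbound: "\<bar>Q n x\<bar> \<le> M * indicator B x" for n x
  proof (cases "x \<in> B")
    case False
    then have nx: "norm x > R + norm e" by (simp add: B_def)
    have te: "norm (t n *\<^sub>R e) \<le> norm e" using t[of n] by (simp add: mult_left_le_one_le)
    have "norm x \<le> norm (t n *\<^sub>R e + x) + norm (t n *\<^sub>R e)"
      by (metis add.commute add_diff_cancel_left' norm_triangle_ineq4)
    then have "norm (t n *\<^sub>R e + x) > R" using te nx by linarith
    then have "t n *\<^sub>R e + x \<notin> C" "x \<notin> C" using R nx
      by (auto simp: subset_iff) (smt (verit) norm_ge_zero)
    then show ?thesis using C(2) False by (simp add: Q_def)
  next
    case True
    obtain z where z: "0 < z" "z < t n" "f (t n *\<^sub>R e + x) - f (0 *\<^sub>R e + x) = (t n - 0) * (f' (z *\<^sub>R e + x) \<bullet> e)"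
      using MVT2[OF t(1)[of n], of "\<lambda>s. f (s *\<^sub>R e + x)" "\<lambda>s. f' (s *\<^sub>R e + x) \<bullet> e"] path by metis
    then have "Q n x = f' (z *\<^sub>R e + x) \<bullet> e"
      using t[of n] by (simp add: Q_def)
    moreover have "z *\<^sub>R e + x \<in> R2"
    proof -
      have "norm (z *\<^sub>R e) \<le> norm e" using z t[of n] by (simp add: mult_left_le_one_le)
      then show ?thesis using True norm_triangle_ineq[of "z *\<^sub>R e" x] by (simp add: B_def R2_def)
    qed
    ultimately show ?thesis using M True by simp
  qed
  have lim: "(\<lambda>n. Q n x) \<longlonglongrightarrow> f' x \<bullet> e" for x
  proof -
    have "((\<lambda>h. (f ((0 + h) *\<^sub>R e + x) - f (0 *\<^sub>R e + x)) / h) \<longlongrightarrow> f' (0 *\<^sub>R e + x) \<bullet> e) (at 0)"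
      using path[of x 0] unfolding DERIV_def by simp
    moreover have "filterlim t (at 0) sequentially"
    proof -
      have "t \<longlonglongrightarrow> 0" unfolding t_def using LIMSEQ_inverse_real_of_nat by (simp add: inverse_eq_divide)
      then show ?thesis using t
        by (auto simp: filterlim_at intro!: always_eventually) (metis less_irrefl)
    qed
    ultimately show ?thesis
      using filterlim_compose by (fastforce simp: Q_def)
  qed
  have dom: "integrable lborel (\<lambda>x. M * indicator B x)"
    by (intro integrable_mult_right integrable_real_indicator) (use emeasure_bounded_finite[OF bounded_cball] in \<open>auto simp: B_def\<close>)
  have Qm: "Q n \<in> borel_measurable lborel" for n
    unfolding Q_def using fm fsm by measurable
  have i: "integrable lborel (\<lambda>x. f' x \<bullet> e)"
    by (rule integrable_dominated_convergence[of "\<lambda>x. f' x \<bullet> e" lborel Q "\<lambda>x. M * indicator B x"])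
      (use f'm Qm dom lim Qbound in auto)
  have "(\<lambda>n. LINT x|lborel. Q n x) \<longlonglongrightarrow> (LINT x|lborel. f' x \<bullet> e)"
    by (rule integral_dominated_convergence[of "\<lambda>x. f' x \<bullet> e" lborel Q "\<lambda>x. M * indicator B x"])
      (use f'm Qm dom lim Qbound in auto)
  then have "(LINT x|lborel. f' x \<bullet> e) = 0" by (simp add: Q0 LIMSEQ_const_iff)
  then show "(LINT x|lebesgue. f' x \<bullet> e) = 0"
    using f'm by (simp add: integral_completion)
  show "integrable lebesgue (\<lambda>x. f' x \<bullet> e)"
    using i f'm by (simp add: integrable_completion)
qed

lemma test_function_gradient_zero:
  assumes "test_function U \<phi> \<phi>'" "x \<notin> closure {x. \<phi> x \<noteq> 0}"
  shows "\<phi>' x = 0"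
proof -
  have "FDERIV \<phi> x :> (\<lambda>h. h \<bullet> \<phi>' x)" using assms by (simp add: test_function_def gderiv_def)
  moreover have "FDERIV \<phi> x :> (\<lambda>h. 0)"
  proof (rule has_derivative_transform_within_open[where f = "\<lambda>x. 0" and s = "- closure {x. \<phi> x \<noteq> 0}"])
    show "0 = \<phi> y" if "y \<in> - closure {x. \<phi> x \<noteq> 0}" for y
      using that closure_subset[of "{x. \<phi> x \<noteq> 0}"] by auto
  qed (use assms in auto)
  ultimately have "(\<lambda>h. h \<bullet> \<phi>' x) = (\<lambda>h. 0)" by (rule has_derivative_unique)
  then show ?thesis by (metis inner_eq_zero_iff)
qed

lemma continuous_compact_support_integrable:
  fixes f :: "'a::euclidean_space \<Rightarrow> real"
  assumes "continuous_on UNIV f" "compact C" "\<And>x. x \<notin> C \<Longrightarrow> f x = 0"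
  shows "integrable lebesgue f"
proof -
  have "(\<lambda>x. indicator C x *\<^sub>R f x) = f" using assms(3) by (force simp: indicator_def)
  then have "integrable lborel f"
    using borel_integrable_compact[OF assms(2), of f] continuous_on_subset[OF assms(1)] by auto
  then show ?thesis
    using borel_measurable_continuous_onI[OF assms(1)] by (simp add: integrable_completion)
qed

lemma continuous_on_C1_components:
  fixes p :: "real^'n \<Rightarrow> real^'n"
  assumes "\<And>i. C1_gradient (\<lambda>x. p x $ i) (P i)"
  shows "continuous_on S p"
proof -
  have "continuous_on S (\<lambda>x. \<chi> i. p x $ i)"
    by (intro continuous_on_vec_lambda C1_gradient_continuous[OF assms])
  then show ?thesis by simp
qed

text \<open>The sum over \<open>i\<close> of the \<open>i\<close>-th partial derivatives of \<open>p\<^sub>i \<phi>\<close>, which are compactly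
  supported, integrates to zero.\<close>

lemma integration_by_parts:
  fixes p :: "real^'n \<Rightarrow> real^'n"
  assumes p: "\<And>i. C1_gradient (\<lambda>x. p x $ i) (P i)" and \<phi>: "test_function U \<phi> \<phi>'"
  shows "(LINT x|lebesgue. p x \<bullet> \<phi>' x) = - (LINT x|lebesgue. (\<Sum>i\<in>UNIV. P i x $ i) * \<phi> x)"
proof -
  let ?C = "closure {x. \<phi> x \<noteq> 0}"
  have C: "compact ?C" using \<phi> by (simp add: test_function_def)
  have out: "\<phi> x = 0" "\<phi>' x = 0" if "x \<notin> ?C" for x
    using that test_function_gradient_zero[OF \<phi>] closure_subset[of "{x. \<phi> x \<noteq> 0}"] by auto
  have g: "C1_gradient \<phi> \<phi>'" using \<phi> by (simp add: test_function_def C1_gradient_def)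
  define F where "F = (\<lambda>i x. (p x $ i) *\<^sub>R \<phi>' x + \<phi> x *\<^sub>R P i x)"
  have F: "C1_gradient (\<lambda>x. p x $ i * \<phi> x) (F i)" for i
    unfolding F_def by (intro C1_gradient_mult p g)
  have z: "integrable lebesgue (\<lambda>x. F i x \<bullet> e)" "(LINT x|lebesgue. F i x \<bullet> e) = 0" for i e
  proof -
    have "p x $ i * \<phi> x = 0" if "x \<notin> ?C" for x
      using out(1)[OF that] by simp
    note integral_directional_derivative_zero[OF F[of i] C this, of e]
    then show "integrable lebesgue (\<lambda>x. F i x \<bullet> e)" "(LINT x|lebesgue. F i x \<bullet> e) = 0"
      by blast+
  qed
  have sum0: "(LINT x|lebesgue. (\<Sum>i\<in>UNIV. F i x \<bullet> axis i 1)) = 0"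
  proof -
    have "(LINT x|lebesgue. (\<Sum>i\<in>UNIV. F i x \<bullet> axis i 1)) = (\<Sum>i\<in>UNIV. LINT x|lebesgue. F i x \<bullet> axis i 1)"
      by (rule Bochner_Integration.integral_sum) (rule z(1))
    then show ?thesis by (simp add: z(2))
  qed
  have eq: "(\<Sum>i\<in>UNIV. F i x \<bullet> axis i 1) = p x \<bullet> \<phi>' x + (\<Sum>i\<in>UNIV. P i x $ i) * \<phi> x" for x
  proof -
    have "F i x \<bullet> axis i 1 = p x $ i * \<phi>' x $ i + P i x $ i * \<phi> x" for i
      by (simp add: F_def inner_axis)
    then show ?thesis by (simp add: inner_vec_def sum.distrib sum_distrib_right)
  qed
  have cp: "continuous_on UNIV p"
    by (rule continuous_on_C1_components[OF p])
  note cont = cp C1_gradient_continuous[OF g, of UNIV] C1_gradient_continuous'[OF g, of UNIV]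
    C1_gradient_continuous'[OF p, of UNIV]
  have "integrable lebesgue (\<lambda>x. p x \<bullet> \<phi>' x)"
    by (rule continuous_compact_support_integrable[OF continuous_on_inner C, OF cont(1,3)])
      (drule out(2), simp)
  moreover have "continuous_on UNIV (\<lambda>x. \<Sum>i\<in>UNIV. P i x $ i)"
    by (intro continuous_on_sum continuous_on_component cont)
  then have "integrable lebesgue (\<lambda>x. (\<Sum>i\<in>UNIV. P i x $ i) * \<phi> x)"
    by (rule continuous_compact_support_integrable[OF continuous_on_mult C, OF _ cont(2)])
      (drule out(1), simp)
  ultimately show ?thesis
    using sum0 by (simp add: eq)
qed

section \<open>Calculus of square-integrable classes\<close>

lemma rep_L2_square_integrable: "square_integrable (rep_L2 f)"
  using Quotient_rep_reflp[OF Quotient_L2, of f] by (simp add: L2_rel_def)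

lemma rep_abs_L2: "square_integrable f \<Longrightarrow> AE x in lebesgue. rep_L2 (abs_L2 f) x = f x"
  using Quotient_rep_abs[OF Quotient_L2, of f] by (simp add: L2_rel_def)

lemma abs_rep_L2: "abs_L2 (rep_L2 f) = f"
  by (rule Quotient_abs_rep[OF Quotient_L2])

lemma L2_eqI: "(AE x in lebesgue. rep_L2 f x = rep_L2 g x) \<Longrightarrow> f = g"
  using Quotient_rel_rep[OF Quotient_L2, of f g] by (simp add: L2_rel_def rep_L2_square_integrable)

lemma L2_rel_rep: "L2_rel (rep_L2 f) (rep_L2 f)"
  by (simp add: L2_rel_def rep_L2_square_integrable)

lemma rep_L2_zero: "AE x in lebesgue. rep_L2 0 x = 0"
  unfolding zero_L2_def by (rule rep_abs_L2[OF square_integrable_0])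

lemma rep_L2_add: "AE x in lebesgue. rep_L2 (f + g) x = rep_L2 f x + rep_L2 g x"
  using rep_abs_L2[OF square_integrable_add[OF rep_L2_square_integrable[of f] rep_L2_square_integrable[of g]]]
    plus_L2.abs_eq[OF L2_rel_rep[of f] L2_rel_rep[of g]] by (simp add: abs_rep_L2)

lemma rep_L2_scaleR: "AE x in lebesgue. rep_L2 (c *\<^sub>R f) x = c *\<^sub>R rep_L2 f x"
  using rep_abs_L2[OF square_integrable_scaleR[OF rep_L2_square_integrable[of f]]]
    scaleR_L2.abs_eq[OF L2_rel_rep[of f]] by (simp add: abs_rep_L2)

lemma rep_L2_sum:
  "finite I \<Longrightarrow> AE x in lebesgue. rep_L2 (\<Sum>i\<in>I. f i) x = (\<Sum>i\<in>I. rep_L2 (f i) x)"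
proof (induction I rule: finite_induct)
  case empty
  then show ?case using rep_L2_zero by simp
next
  case (insert i I)
  from insert.IH rep_L2_add[of "f i" "\<Sum>i\<in>I. f i"] show ?case
    by eventually_elim (use insert in simp)
qed

lemma continuous_compact_support_square_integrable:
  fixes f :: "'a::euclidean_space \<Rightarrow> 'b::euclidean_space"
  assumes f: "continuous_on UNIV f" and C: "compact C" "\<And>x. x \<notin> C \<Longrightarrow> f x = 0"
  shows "square_integrable f"
proof -
  have "integrable lebesgue (\<lambda>x. (norm (f x))\<^sup>2)"
    by (rule continuous_compact_support_integrable[OF _ C(1)]) (use f C in \<open>auto intro!: continuous_intros\<close>)
  moreover have "f \<in> borel_measurable lebesgue"
    using f by (rule continuous_imp_lebesgue_measurable)
  ultimately show ?thesis by (simp add: square_integrable_def)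
qed

lemma square_integrable_bounded_set:
  fixes f :: "'a::euclidean_space \<Rightarrow> 'b::euclidean_space"
  assumes f: "continuous_on UNIV f" and M: "M \<in> sets lebesgue" "M \<subseteq> K" "compact K"
  shows "square_integrable (\<lambda>x. indicator M x *\<^sub>R f x)"
proof -
  have fm: "f \<in> borel_measurable lebesgue"
    using f by (rule continuous_imp_lebesgue_measurable)
  have m: "(\<lambda>x. indicator M x *\<^sub>R f x) \<in> borel_measurable lebesgue"
    using fm M(1) by measurable
  have "integrable lborel (\<lambda>x. indicator K x *\<^sub>R (norm (f x))\<^sup>2)"
    using M(3) continuous_on_subset[OF f] by (intro borel_integrable_compact continuous_intros) auto
  then have "integrable lebesgue (\<lambda>x. indicator K x *\<^sub>R (norm (f x))\<^sup>2)"
    by (subst integrable_completion) auto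
  then have "integrable lebesgue (\<lambda>x. (norm (indicator M x *\<^sub>R f x))\<^sup>2)"
  proof (rule Bochner_Integration.integrable_bound)
    show "(\<lambda>x. (norm (indicator M x *\<^sub>R f x))\<^sup>2) \<in> borel_measurable lebesgue"
      using m by measurable
    show "AE x in lebesgue. norm ((norm (indicator M x *\<^sub>R f x))\<^sup>2) \<le> norm (indicator K x *\<^sub>R (norm (f x))\<^sup>2)"
      using M(2) by (intro AE_I2) (auto simp: indicator_def)
  qed
  then show ?thesis using m by (simp add: square_integrable_def)
qed

lemma locally_integrable_continuous:
  assumes "continuous_on UNIV f" shows "locally_integrable f"
  unfolding locally_integrable_def
proof (intro conjI allI impI)
  have f: "f \<in> borel_measurable borel"
    using borel_measurable_continuous_onI[OF assms] .
  show "f \<in> borel_measurable lebesgue"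
    using assms by (rule continuous_imp_lebesgue_measurable)
  fix K :: "'a set" assume K: "compact K"
  have "integrable lborel (\<lambda>x. indicator K x *\<^sub>R f x)"
    using K continuous_on_subset[OF assms] by (intro borel_integrable_compact) auto
  then show "integrable lebesgue (\<lambda>x. indicator K x * f x)"
    by (subst integrable_completion) auto
qed

lemma locally_integrable_rep_L2: "locally_integrable (rep_L2 g)"
  unfolding locally_integrable_def
proof (intro conjI allI impI)
  show "rep_L2 g \<in> borel_measurable lebesgue"
    using rep_L2_square_integrable by (auto simp: square_integrable_def)
  fix K :: "'a set" assume K: "compact K"
  then have "square_integrable (\<lambda>x. indicator K x *\<^sub>R (1::real))"
    by (intro square_integrable_bounded_set[of _ K K]) (auto simp: compact_imp_closed)
  from square_integrable_inner[OF this rep_L2_square_integrable[of g]]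
  show "integrable lebesgue (\<lambda>x. indicator K x * rep_L2 g x)" by simp
qed

lemma locally_integrable_diff:
  assumes "locally_integrable f" "locally_integrable g"
  shows "locally_integrable (\<lambda>x. f x - g x)"
  using assms by (auto simp: locally_integrable_def right_diff_distrib)

lemma subspace_L2_on: "subspace (L2_on \<Omega>)"
  unfolding subspace_def
proof (intro conjI ballI allI)
  show "0 \<in> L2_on \<Omega>"
    unfolding L2_on_def using rep_L2_zero by (auto elim: AE_mp)
  show "f + g \<in> L2_on \<Omega>" if "f \<in> L2_on \<Omega>" "g \<in> L2_on \<Omega>" for f g :: "('a, 'b) L2"
    using that rep_L2_add[of f g] unfolding L2_on_def mem_Collect_eq
    by eventually_elim auto
  show "c *\<^sub>R f \<in> L2_on \<Omega>" if "f \<in> L2_on \<Omega>" for c and f :: "('a, 'b) L2"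
    using that rep_L2_scaleR[of c f] unfolding L2_on_def mem_Collect_eq
    by eventually_elim auto
qed

section \<open>The weak divergence\<close>

lemma test_function_square_integrable:
  assumes "test_function \<Omega> \<phi> \<phi>'"
  shows "square_integrable \<phi>" "square_integrable \<phi>'"
proof -
  have C: "compact (closure {x. \<phi> x \<noteq> 0})" and g: "C1_gradient \<phi> \<phi>'"
    using assms by (auto simp: test_function_def C1_gradient_def)
  show "square_integrable \<phi>"
    by (rule continuous_compact_support_square_integrable[OF C1_gradient_continuous[OF g] C])
      (use closure_subset[of "{x. \<phi> x \<noteq> 0}"] in auto)
  show "square_integrable \<phi>'"
    by (rule continuous_compact_support_square_integrable[OF C1_gradient_continuous'[OF g] C])
      (use test_function_gradient_zero[OF assms] in auto)
qed

lemma test_function_integrable: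
  assumes "test_function \<Omega> \<phi> \<phi>'"
  shows "integrable lebesgue (\<lambda>x. rep_L2 g x * \<phi> x)" "integrable lebesgue (\<lambda>x. rep_L2 \<sigma> x \<bullet> \<phi>' x)"
  using square_integrable_inner[OF rep_L2_square_integrable[of g] test_function_square_integrable(1)[OF assms]]
    square_integrable_inner[OF rep_L2_square_integrable[of \<sigma>] test_function_square_integrable(2)[OF assms]]
  by simp_all

lemma integral_cong_AE_L2:
  fixes f g :: "'a::euclidean_space \<Rightarrow> real"
  assumes "AE x in lebesgue. f x = g x" "integrable lebesgue f" "integrable lebesgue g"
  shows "(LINT x|lebesgue. f x) = (LINT x|lebesgue. g x)"
  using assms by (intro integral_cong_AE) auto

lemma has_weak_div_zero: "has_weak_div \<Omega> 0 0"
proof -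
  have "(LINT x|lebesgue. rep_L2 (0 :: ('a, 'a) L2) x \<bullet> \<phi>' x) = 0"
    "(LINT x|lebesgue. rep_L2 (0 :: ('a, real) L2) x * \<phi> x) = 0" for \<phi> :: "'a \<Rightarrow> real" and \<phi>' :: "'a \<Rightarrow> 'a"
  proof -
    have "AE x in lebesgue. rep_L2 (0 :: ('a, 'a) L2) x \<bullet> \<phi>' x = 0"
      using rep_L2_zero[where 'a = 'a and 'b = 'a] by eventually_elim simp
    then show "(LINT x|lebesgue. rep_L2 (0 :: ('a, 'a) L2) x \<bullet> \<phi>' x) = 0"
      by (rule integral_eq_zero_AE)
    have "AE x in lebesgue. rep_L2 (0 :: ('a, real) L2) x * \<phi> x = 0"
      using rep_L2_zero[where 'a = 'a and 'b = real] by eventually_elim simp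
    then show "(LINT x|lebesgue. rep_L2 (0 :: ('a, real) L2) x * \<phi> x) = 0"
      by (rule integral_eq_zero_AE)
  qed
  then show ?thesis by (simp add: has_weak_div_def)
qed

lemma has_weak_div_add:
  assumes "has_weak_div \<Omega> \<sigma> g" "has_weak_div \<Omega> \<tau> k"
  shows "has_weak_div \<Omega> (\<sigma> + \<tau>) (g + k)"
  unfolding has_weak_div_def
proof (intro allI impI)
  fix \<phi> \<phi>' assume t: "test_function \<Omega> \<phi> \<phi>'"
  note i = test_function_integrable[OF t]
  have "AE x in lebesgue. rep_L2 (\<sigma> + \<tau>) x \<bullet> \<phi>' x = rep_L2 \<sigma> x \<bullet> \<phi>' x + rep_L2 \<tau> x \<bullet> \<phi>' x"
    using rep_L2_add[of \<sigma> \<tau>] by eventually_elim (simp add: inner_add_left)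
  then have 1: "(LINT x|lebesgue. rep_L2 (\<sigma> + \<tau>) x \<bullet> \<phi>' x)
      = (LINT x|lebesgue. rep_L2 \<sigma> x \<bullet> \<phi>' x + rep_L2 \<tau> x \<bullet> \<phi>' x)"
    by (rule integral_cong_AE_L2) (intro i Bochner_Integration.integrable_add)+
  have "AE x in lebesgue. rep_L2 (g + k) x * \<phi> x = rep_L2 g x * \<phi> x + rep_L2 k x * \<phi> x"
    using rep_L2_add[of g k] by eventually_elim (simp add: distrib_right)
  then have 2: "(LINT x|lebesgue. rep_L2 (g + k) x * \<phi> x)
      = (LINT x|lebesgue. rep_L2 g x * \<phi> x + rep_L2 k x * \<phi> x)"
    by (rule integral_cong_AE_L2) (intro i Bochner_Integration.integrable_add)+
  show "(LINT x|lebesgue. rep_L2 (\<sigma> + \<tau>) x \<bullet> \<phi>' x) = - (LINT x|lebesgue. rep_L2 (g + k) x * \<phi> x)"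
    unfolding 1 2 using assms t i by (simp add: has_weak_div_def)
qed

lemma has_weak_div_scaleR:
  assumes "has_weak_div \<Omega> \<sigma> g"
  shows "has_weak_div \<Omega> (c *\<^sub>R \<sigma>) (c *\<^sub>R g)"
  unfolding has_weak_div_def
proof (intro allI impI)
  fix \<phi> \<phi>' assume t: "test_function \<Omega> \<phi> \<phi>'"
  note i = test_function_integrable[OF t]
  have "AE x in lebesgue. rep_L2 (c *\<^sub>R \<sigma>) x \<bullet> \<phi>' x = c * (rep_L2 \<sigma> x \<bullet> \<phi>' x)"
    using rep_L2_scaleR[of c \<sigma>] by eventually_elim simp
  then have 1: "(LINT x|lebesgue. rep_L2 (c *\<^sub>R \<sigma>) x \<bullet> \<phi>' x) = (LINT x|lebesgue. c * (rep_L2 \<sigma> x \<bullet> \<phi>' x))"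
    by (rule integral_cong_AE_L2) (intro i integrable_mult_right)+
  have "AE x in lebesgue. rep_L2 (c *\<^sub>R g) x * \<phi> x = c * (rep_L2 g x * \<phi> x)"
    using rep_L2_scaleR[of c g] by eventually_elim simp
  then have 2: "(LINT x|lebesgue. rep_L2 (c *\<^sub>R g) x * \<phi> x) = (LINT x|lebesgue. c * (rep_L2 g x * \<phi> x))"
    by (rule integral_cong_AE_L2) (intro i integrable_mult_right)+
  show "(LINT x|lebesgue. rep_L2 (c *\<^sub>R \<sigma>) x \<bullet> \<phi>' x) = - (LINT x|lebesgue. rep_L2 (c *\<^sub>R g) x * \<phi> x)"
    unfolding 1 2 using assms t by (simp add: has_weak_div_def)
qed

lemma has_weak_div_unique:
  fixes \<Omega> :: "'a::euclidean_space set"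
  assumes \<Omega>: "open \<Omega>" and g: "g \<in> L2_on \<Omega>" "has_weak_div \<Omega> \<sigma> g" and k: "k \<in> L2_on \<Omega>" "has_weak_div \<Omega> \<sigma> k"
  shows "g = k"
proof (rule L2_eqI)
  have "AE x in lebesgue. x \<in> \<Omega> \<longrightarrow> rep_L2 g x - rep_L2 k x = 0"
  proof (rule fundamental_lemma[OF locally_integrable_diff[OF locally_integrable_rep_L2 locally_integrable_rep_L2] \<Omega>])
    fix \<phi> \<phi>' assume t: "test_function \<Omega> \<phi> \<phi>'"
    then have "(LINT x|lebesgue. rep_L2 g x * \<phi> x) = (LINT x|lebesgue. rep_L2 k x * \<phi> x)"
      using g(2) k(2) by (force simp: has_weak_div_def)
    then show "(LINT x|lebesgue. (rep_L2 g x - rep_L2 k x) * \<phi> x) = 0"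
      using test_function_integrable(1)[OF t] by (simp add: left_diff_distrib)
  qed
  moreover have "AE x in lebesgue. x \<notin> \<Omega> \<longrightarrow> rep_L2 g x = 0" "AE x in lebesgue. x \<notin> \<Omega> \<longrightarrow> rep_L2 k x = 0"
    using g(1) k(1) by (simp_all add: L2_on_def)
  ultimately show "AE x in lebesgue. rep_L2 g x = rep_L2 k x"
    by eventually_elim auto
qed

lemma weak_div_eqI:
  assumes "open \<Omega>" "g \<in> L2_on \<Omega>" "has_weak_div \<Omega> \<sigma> g"
  shows "weak_div \<Omega> \<sigma> = g"
  unfolding weak_div_def using assms has_weak_div_unique by blast

lemma weak_divD:
  assumes "open \<Omega>" "\<sigma> \<in> Hdiv \<Omega>"
  shows "weak_div \<Omega> \<sigma> \<in> L2_on \<Omega>" "has_weak_div \<Omega> \<sigma> (weak_div \<Omega> \<sigma>)"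
  using assms weak_div_eqI by (fastforce simp: Hdiv_def)+

lemma subspace_Hdiv: "subspace (Hdiv \<Omega>)"
  unfolding subspace_def
proof (intro conjI ballI allI)
  show "0 \<in> Hdiv \<Omega>"
    unfolding Hdiv_def
    by (intro CollectI conjI bexI[where x = 0] has_weak_div_zero subspace_0[OF subspace_L2_on])
  show "\<sigma> + \<tau> \<in> Hdiv \<Omega>" if st: "\<sigma> \<in> Hdiv \<Omega>" "\<tau> \<in> Hdiv \<Omega>" for \<sigma> \<tau>
  proof -
    from st obtain g k where "\<sigma> \<in> L2_on \<Omega>" "g \<in> L2_on \<Omega>" "has_weak_div \<Omega> \<sigma> g"
      "\<tau> \<in> L2_on \<Omega>" "k \<in> L2_on \<Omega>" "has_weak_div \<Omega> \<tau> k"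
      unfolding Hdiv_def by blast
    then show ?thesis
      unfolding Hdiv_def
      by (intro CollectI conjI bexI[where x = "g + k"] has_weak_div_add subspace_add[OF subspace_L2_on])
  qed
  show "c *\<^sub>R \<sigma> \<in> Hdiv \<Omega>" if s: "\<sigma> \<in> Hdiv \<Omega>" for c \<sigma>
  proof -
    from s obtain g where "\<sigma> \<in> L2_on \<Omega>" "g \<in> L2_on \<Omega>" "has_weak_div \<Omega> \<sigma> g"
      unfolding Hdiv_def by blast
    then show ?thesis
      unfolding Hdiv_def
      by (intro CollectI conjI bexI[where x = "c *\<^sub>R g"] has_weak_div_scaleR subspace_scale[OF subspace_L2_on])
  qed
qed

lemma weak_div_linear:
  assumes \<Omega>: "open \<Omega>" and V: "V \<subseteq> Hdiv \<Omega>"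
  shows "linear_on_subspace V (weak_div \<Omega>)"
  unfolding linear_on_subspace_def
proof (intro conjI ballI allI)
  note w = weak_divD[OF \<Omega> subsetD[OF V]]
  show "weak_div \<Omega> (\<sigma> + \<tau>) = weak_div \<Omega> \<sigma> + weak_div \<Omega> \<tau>" if "\<sigma> \<in> V" "\<tau> \<in> V" for \<sigma> \<tau>
    by (intro weak_div_eqI[OF \<Omega>] subspace_add[OF subspace_L2_on] has_weak_div_add w that)
  show "weak_div \<Omega> (c *\<^sub>R \<sigma>) = c *\<^sub>R weak_div \<Omega> \<sigma>" if "\<sigma> \<in> V" for c \<sigma>
    by (intro weak_div_eqI[OF \<Omega>] subspace_scale[OF subspace_L2_on] has_weak_div_scaleR w that)
qed

section \<open>Polynomials and Raviart--Thomas fields\<close>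

definition multi_indices :: "nat \<Rightarrow> ('n::finite \<Rightarrow> nat) set" where
  "multi_indices r = {\<alpha>. (\<Sum>i\<in>UNIV. \<alpha> i) \<le> r}"

definition monomial :: "('n::finite \<Rightarrow> nat) \<Rightarrow> real^'n \<Rightarrow> real" where
  "monomial \<alpha> x = (\<Prod>i\<in>UNIV. (x $ i) ^ \<alpha> i)"

lemma finite_multi_indices: "finite (multi_indices r :: ('n::finite \<Rightarrow> nat) set)"
proof (rule finite_subset)
  show "multi_indices r \<subseteq> (PiE UNIV (\<lambda>_. {..r}) :: ('n \<Rightarrow> nat) set)"
  proof
    fix \<alpha> :: "'n \<Rightarrow> nat" assume \<alpha>: "\<alpha> \<in> multi_indices r"
    have "\<alpha> i \<le> (\<Sum>i\<in>UNIV. \<alpha> i)" for i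
      by (rule member_le_sum) auto
    then have "\<alpha> i \<le> r" for i
      using \<alpha> unfolding multi_indices_def mem_Collect_eq by (rule order_trans)
    then show "\<alpha> \<in> PiE UNIV (\<lambda>_. {..r})"
      by (simp add: PiE_iff)
  qed
qed (intro finite_PiE; simp)

lemma poly_fun_eq: "poly_fun r = {p. \<exists>c. p = (\<lambda>x. \<Sum>\<alpha>\<in>multi_indices r. c \<alpha> * monomial \<alpha> x)}"
  by (simp add: poly_fun_def multi_indices_def monomial_def)

lemma monomial_continuous: "continuous_on S (monomial \<alpha>)"
  unfolding monomial_def by (intro continuous_intros)

lemma poly_fun_zero: "(\<lambda>x. 0) \<in> poly_fun r"
  unfolding poly_fun_eq by (auto intro!: exI[of _ "\<lambda>_. 0"])

lemma poly_fun_add: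
  assumes "p \<in> poly_fun r" "q \<in> poly_fun r" shows "(\<lambda>x. p x + q x) \<in> poly_fun r"
proof -
  from assms obtain c d where "p = (\<lambda>x. \<Sum>\<alpha>\<in>multi_indices r. c \<alpha> * monomial \<alpha> x)"
    "q = (\<lambda>x. \<Sum>\<alpha>\<in>multi_indices r. d \<alpha> * monomial \<alpha> x)"
    by (auto simp: poly_fun_eq)
  then show ?thesis
    unfolding poly_fun_eq
    by (auto simp: sum.distrib[symmetric] distrib_right intro!: exI[of _ "\<lambda>\<alpha>. c \<alpha> + d \<alpha>"])
qed

lemma poly_fun_cmult:
  assumes "p \<in> poly_fun r" shows "(\<lambda>x. k * p x) \<in> poly_fun r"
proof -
  from assms obtain c where "p = (\<lambda>x. \<Sum>\<alpha>\<in>multi_indices r. c \<alpha> * monomial \<alpha> x)"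
    by (auto simp: poly_fun_eq)
  then show ?thesis
    unfolding poly_fun_eq
    by (auto simp: sum_distrib_left mult.assoc intro!: exI[of _ "\<lambda>\<alpha>. k * c \<alpha>"])
qed

lemma poly_fun_sum:
  assumes "\<And>i. i \<in> I \<Longrightarrow> p i \<in> poly_fun r" shows "(\<lambda>x. \<Sum>i\<in>I. p i x) \<in> poly_fun r"
proof (cases "finite I")
  case True
  then show ?thesis using assms by (induction I) (auto simp: poly_fun_zero poly_fun_add)
qed (simp add: poly_fun_zero)

lemma monomial_in_poly_fun:
  assumes "\<alpha> \<in> multi_indices r" shows "monomial \<alpha> \<in> poly_fun r"
  unfolding poly_fun_eq
proof (intro CollectI exI ext)
  fix x
  have "(\<Sum>\<beta>\<in>multi_indices r. (if \<beta> = \<alpha> then 1 else 0) * monomial \<beta> x)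
      = (\<Sum>\<beta>\<in>multi_indices r. if \<beta> = \<alpha> then monomial \<beta> x else 0)"
    by (intro sum.cong) auto
  then show "monomial \<alpha> x = (\<Sum>\<beta>\<in>multi_indices r. (if \<beta> = \<alpha> then 1 else 0) * monomial \<beta> x)"
    using assms by (simp add: finite_multi_indices)
qed

lemma poly_fun_continuous:
  assumes "p \<in> poly_fun r" shows "continuous_on S p"
proof -
  from assms obtain c where "p = (\<lambda>x. \<Sum>\<alpha>\<in>multi_indices r. c \<alpha> * monomial \<alpha> x)"
    by (auto simp: poly_fun_eq)
  then show ?thesis by (auto intro!: continuous_intros monomial_continuous)
qed

lemma monomial_gradient:
  fixes \<alpha> :: "'n::finite \<Rightarrow> nat"
  shows "C1_gradient (monomial \<alpha>) (\<lambda>x. \<chi> i. real (\<alpha> i) * monomial (\<alpha>(i := \<alpha> i - 1)) x)"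
  unfolding C1_gradient_def
proof (intro conjI allI)
  fix x :: "real^'n"
  have drop: "monomial (\<alpha>(i := \<alpha> i - 1)) x = (x $ i) ^ (\<alpha> i - 1) * (\<Prod>j\<in>UNIV - {i}. (x $ j) ^ \<alpha> j)" for i
    unfolding monomial_def by (subst prod.remove[of UNIV i]) (auto intro!: prod.cong)
  have "((\<lambda>x. \<Prod>i\<in>UNIV. (x $ i) ^ \<alpha> i) has_derivative
     (\<lambda>h. \<Sum>i\<in>UNIV. (real (\<alpha> i) * h $ i * (x $ i) ^ (\<alpha> i - 1)) * (\<Prod>j\<in>UNIV - {i}. (x $ j) ^ \<alpha> j))) (at x)"
    by (intro has_derivative_prod) (auto intro!: derivative_eq_intros bounded_linear.has_derivative[OF bounded_linear_vec_nth])
  moreover have "(\<lambda>h. \<Sum>i\<in>UNIV. (real (\<alpha> i) * h $ i * (x $ i) ^ (\<alpha> i - 1)) * (\<Prod>j\<in>UNIV - {i}. (x $ j) ^ \<alpha> j))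
     = (\<lambda>h. h \<bullet> (\<chi> i. real (\<alpha> i) * monomial (\<alpha>(i := \<alpha> i - 1)) x))"
    by (simp only: inner_vec_def vec_lambda_beta drop) (simp add: mult_ac)
  ultimately show "GDERIV (monomial \<alpha>) x :> (\<chi> i. real (\<alpha> i) * monomial (\<alpha>(i := \<alpha> i - 1)) x)"
    unfolding gderiv_def by (simp add: monomial_def[abs_def])
qed (intro continuous_intros monomial_continuous)

text \<open>The third property is Euler's relation: \<open>x\<^sub>i \<partial>\<^sub>i\<close> multiplies each monomial by its exponent
  of \<open>x\<^sub>i\<close> and so does not raise the degree. It handles the part \<open>q x\<close> of a Raviart--Thomas
  field.\<close>

lemma poly_fun_gradient:
  fixes p :: "real^'n \<Rightarrow> real"
  assumes "p \<in> poly_fun r"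
  obtains p' where "C1_gradient p p'" "\<And>i. (\<lambda>x. p' x $ i) \<in> poly_fun r"
    "\<And>i. (\<lambda>x. x $ i * p' x $ i) \<in> poly_fun r"
proof -
  from assms obtain c where p: "p = (\<lambda>x. \<Sum>\<alpha>\<in>multi_indices r. c \<alpha> * monomial \<alpha> x)"
    by (auto simp: poly_fun_eq)
  define m' where "m' = (\<lambda>\<alpha> x. \<chi> i. real (\<alpha> i) * monomial (\<alpha>(i := \<alpha> i - 1)) (x :: real^'n))"
  define p' where "p' = (\<lambda>x. \<Sum>\<alpha>\<in>multi_indices r. c \<alpha> *\<^sub>R m' \<alpha> x + monomial \<alpha> x *\<^sub>R 0)"
  have 1: "C1_gradient p p'"
    unfolding p p'_def m'_def
    by (intro C1_gradient_sum C1_gradient_mult C1_gradient_const monomial_gradient)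
  have low: "\<alpha>(i := \<alpha> i - Suc 0) \<in> multi_indices r" if "\<alpha> \<in> multi_indices r" for \<alpha> and i :: 'n
  proof -
    have "(\<Sum>j\<in>UNIV. (\<alpha>(i := \<alpha> i - Suc 0)) j) \<le> (\<Sum>j\<in>UNIV. \<alpha> j)"
      by (intro sum_mono) auto
    then show ?thesis using that by (simp add: multi_indices_def)
  qed
  have 2: "(\<lambda>x. p' x $ i) \<in> poly_fun r" for i
    unfolding p'_def m'_def by (simp add: mult.assoc[symmetric])
      (intro poly_fun_sum poly_fun_cmult monomial_in_poly_fun low)
  have euler: "x $ i * m' \<alpha> x $ i = real (\<alpha> i) * monomial \<alpha> x" for x \<alpha> i
  proof (cases "\<alpha> i")
    case (Suc k)
    have "x $ i * monomial (\<alpha>(i := k)) x = monomial \<alpha> x"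
      unfolding monomial_def
      by (subst (1 2) prod.remove[of UNIV i]) (auto simp: Suc mult.assoc[symmetric] intro!: prod.cong)
    then show ?thesis by (simp add: m'_def Suc mult.left_commute)
  qed (simp add: m'_def)
  have "(\<lambda>x. x $ i * p' x $ i) = (\<lambda>x. \<Sum>\<alpha>\<in>multi_indices r. (c \<alpha> * real (\<alpha> i)) * monomial \<alpha> x)" for i
    by (simp add: p'_def sum_distrib_left mult.left_commute[of _ "c _"] euler mult.assoc)
  then have 3: "(\<lambda>x. x $ i * p' x $ i) \<in> poly_fun r" for i
    by (simp only:) (intro poly_fun_sum poly_fun_cmult monomial_in_poly_fun)
  show thesis using that 1 2 3 by blast
qed

text \<open>The divergence of \<open>p + q x\<close> is \<open>div p + n q + x \<bullet> grad q\<close>, and \<open>x \<bullet> grad q\<close> has at most the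
  degree of \<open>q\<close>.\<close>

lemma RT_fun_divergence:
  fixes f :: "real^'n \<Rightarrow> real^'n"
  assumes "f \<in> RT_fun r"
  obtains P where "\<And>i. C1_gradient (\<lambda>x. f x $ i) (P i)" "(\<lambda>x. \<Sum>i\<in>UNIV. P i x $ i) \<in> poly_fun r"
proof -
  from assms obtain p q where f: "f = (\<lambda>x. p x + q x *\<^sub>R x)" and p: "\<And>i. (\<lambda>x. p x $ i) \<in> poly_fun r"
    and q: "q \<in> poly_fun r"
    by (auto simp: RT_fun_def)
  have "\<forall>i. \<exists>p'. C1_gradient (\<lambda>x. p x $ i) p' \<and> (\<forall>j. (\<lambda>x. p' x $ j) \<in> poly_fun r)"
    using poly_fun_gradient[OF p] by metis
  then obtain p' where p': "\<And>i. C1_gradient (\<lambda>x. p x $ i) (p' i)" "\<And>i j. (\<lambda>x. p' i x $ j) \<in> poly_fun r"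
    by metis
  obtain q' where q': "C1_gradient q q'" "\<And>i. (\<lambda>x. x $ i * q' x $ i) \<in> poly_fun r"
    using poly_fun_gradient[OF q] by metis
  define P where "P = (\<lambda>i x. p' i x + (q x *\<^sub>R axis i 1 + (x \<bullet> axis i 1) *\<^sub>R q' x))"
  have "C1_gradient (\<lambda>x. p x $ i + q x * (x \<bullet> axis i 1)) (P i)" for i
    unfolding P_def by (intro C1_gradient_add C1_gradient_mult p' q' C1_gradient_inner)
  then have 1: "C1_gradient (\<lambda>x. f x $ i) (P i)" for i
    by (simp add: f inner_axis)
  have "P i x $ i = p' i x $ i + (q x + x $ i * q' x $ i)" for i x
    by (simp add: P_def inner_axis)
  then have "(\<lambda>x. \<Sum>i\<in>UNIV. P i x $ i) \<in> poly_fun r"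
    by (simp only:) (intro poly_fun_sum poly_fun_add p' q q')
  with 1 that show thesis by blast
qed

section \<open>Finite element spaces\<close>

lemma triangulatesD:
  fixes \<T> :: "'a::euclidean_space set set"
  assumes "triangulates \<T> \<Omega>"
  shows "finite \<T>" "T \<in> \<T> \<Longrightarrow> compact T" "T \<in> \<T> \<Longrightarrow> convex T" "\<Union>\<T> = closure \<Omega>"
proof -
  show "finite \<T>" "\<Union>\<T> = closure \<Omega>"
    using assms by (auto simp: triangulates_def triangulation_def)
  assume "T \<in> \<T>"
  then have "int DIM('a) simplex T" using assms by (auto simp: triangulates_def)
  then show "compact T" "convex T"
    using simplex_imp_polytope polytope_imp_compact polytope_imp_convex by blast+
qed

text \<open>The atoms, i.e. the sets of points with a given incidence to the members of \<open>\<T>\<close>, are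
  finitely many and disjoint. On each atom that lies in some \<open>T0\<close> of \<open>\<T>\<close>, a function in \<open>X\<close> is a
  combination of the \<open>b k\<close>, so \<open>X\<close> is spanned by the products of the \<open>b k\<close> with the indicators of
  the atoms. Working with atoms makes overlaps of the members of \<open>\<T>\<close> harmless.\<close>

lemma piecewise_finite_dimensional:
  fixes b :: "'k \<Rightarrow> 'a::euclidean_space \<Rightarrow> 'b::euclidean_space" and \<T> :: "'a set set"
  assumes K: "finite K" "\<And>k. k \<in> K \<Longrightarrow> continuous_on UNIV (b k)"
    and F: "\<And>p. p \<in> F \<Longrightarrow> \<exists>c. p = (\<lambda>x. \<Sum>k\<in>K. c k *\<^sub>R b k x)"
    and \<T>: "finite \<T>" "\<And>T. T \<in> \<T> \<Longrightarrow> compact T"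
    and X: "\<And>u T. u \<in> X \<Longrightarrow> T \<in> \<T> \<Longrightarrow> \<exists>p\<in>F. AE x in lebesgue. x \<in> T \<longrightarrow> rep_L2 u x = p x"
      "\<And>u. u \<in> X \<Longrightarrow> AE x in lebesgue. x \<notin> \<Union>\<T> \<longrightarrow> rep_L2 u x = 0"
  shows "\<exists>B. finite B \<and> X \<subseteq> span B"
proof -
  define atom where "atom = (\<lambda>A. {x. \<forall>T\<in>\<T>. x \<in> T \<longleftrightarrow> T \<in> A})"
  define \<A> where "\<A> = Pow \<T> - {{}}"
  have finA: "finite \<A>" using \<T> by (simp add: \<A>_def)
  define T0 where "T0 = (\<lambda>A::'a set set. SOME T. T \<in> A)"
  have T0: "T0 A \<in> A" "T0 A \<in> \<T>" if "A \<in> \<A>" for A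
    using that some_in_eq[of A] by (auto simp: T0_def \<A>_def)
  have atomT: "atom A \<subseteq> T0 A" if "A \<in> \<A>" for A
    using T0[OF that] by (auto simp: atom_def)
  have atom_m: "atom A \<in> sets lebesgue" for A
  proof -
    have "{x \<in> space lebesgue. x \<in> T \<longleftrightarrow> T \<in> A} \<in> sets lebesgue" if "T \<in> \<T>" for T
    proof -
      have T: "T \<in> sets lebesgue" using \<T>(2)[OF that] by (simp add: compact_imp_closed)
      have "- T \<in> sets lebesgue" using sets.compl_sets[OF T] by (simp add: Compl_eq_Diff_UNIV)
      with T show ?thesis by (cases "T \<in> A") (simp_all add: Compl_eq)
    qed
    then have "{x \<in> space lebesgue. \<forall>T\<in>\<T>. x \<in> T \<longleftrightarrow> T \<in> A} \<in> sets lebesgue"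
      using \<T>(1) by (intro sets.sets_Collect_finite_All)
    then show ?thesis by (simp add: atom_def)
  qed
  define e where "e = (\<lambda>A k. abs_L2 (\<lambda>x. indicator (atom A) x *\<^sub>R b k x))"
  have e: "AE x in lebesgue. rep_L2 (e A k) x = indicator (atom A) x *\<^sub>R b k x" if "A \<in> \<A>" "k \<in> K" for A k
    unfolding e_def
    using that by (intro rep_abs_L2 square_integrable_bounded_set[OF K(2) atom_m atomT \<T>(2)] T0)
  define B where "B = (\<lambda>(A, k). e A k) ` (\<A> \<times> K)"
  have "u \<in> span B" if u: "u \<in> X" for u
  proof -
    have "\<forall>T\<in>\<T>. \<exists>c. AE x in lebesgue. x \<in> T \<longrightarrow> rep_L2 u x = (\<Sum>k\<in>K. c k *\<^sub>R b k x)"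
    proof
      fix T assume "T \<in> \<T>"
      then obtain p where p: "p \<in> F" "AE x in lebesgue. x \<in> T \<longrightarrow> rep_L2 u x = p x"
        using X(1)[OF u] by blast
      obtain c where "p = (\<lambda>x. \<Sum>k\<in>K. c k *\<^sub>R b k x)"
        using F[OF p(1)] by blast
      with p(2) show "\<exists>c. AE x in lebesgue. x \<in> T \<longrightarrow> rep_L2 u x = (\<Sum>k\<in>K. c k *\<^sub>R b k x)"
        by auto
    qed
    then obtain c where c: "\<forall>T\<in>\<T>. AE x in lebesgue. x \<in> T \<longrightarrow> rep_L2 u x = (\<Sum>k\<in>K. c T k *\<^sub>R b k x)"
      by (rule bchoice[THEN exE])
    define v where "v = (\<Sum>A\<in>\<A>. \<Sum>k\<in>K. c (T0 A) k *\<^sub>R e A k)"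
    have "AE x in lebesgue. \<forall>T\<in>\<T>. x \<in> T \<longrightarrow> rep_L2 u x = (\<Sum>k\<in>K. c T k *\<^sub>R b k x)"
      using c \<T>(1) by (intro AE_finite_allI) blast+
    moreover have "AE x in lebesgue. \<forall>A\<in>\<A>. \<forall>k\<in>K. rep_L2 (c (T0 A) k *\<^sub>R e A k) x = c (T0 A) k *\<^sub>R indicator (atom A) x *\<^sub>R b k x"
    proof (intro AE_finite_allI finA K(1))
      fix A k assume Ak: "A \<in> \<A>" "k \<in> K"
      from e[OF Ak] rep_L2_scaleR[of "c (T0 A) k" "e A k"]
      show "AE x in lebesgue. rep_L2 (c (T0 A) k *\<^sub>R e A k) x = c (T0 A) k *\<^sub>R indicator (atom A) x *\<^sub>R b k x"
        by eventually_elim simp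
    qed
    moreover have "AE x in lebesgue. \<forall>A\<in>\<A>. rep_L2 (\<Sum>k\<in>K. c (T0 A) k *\<^sub>R e A k) x = (\<Sum>k\<in>K. rep_L2 (c (T0 A) k *\<^sub>R e A k) x)"
      by (intro AE_finite_allI finA rep_L2_sum K(1))
    moreover have "AE x in lebesgue. rep_L2 v x = (\<Sum>A\<in>\<A>. rep_L2 (\<Sum>k\<in>K. c (T0 A) k *\<^sub>R e A k) x)"
      unfolding v_def by (intro rep_L2_sum finA)
    moreover note X(2)[OF u]
    ultimately have "AE x in lebesgue. rep_L2 u x = rep_L2 v x"
    proof eventually_elim
      case (elim x)
      define A where "A = {T \<in> \<T>. x \<in> T}"
      have ind: "indicator (atom A') x = (if A' = A then 1 else (0::real))" if "A' \<in> \<A>" for A'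
        using that by (auto simp: A_def atom_def \<A>_def indicator_def)
      have "rep_L2 v x = (\<Sum>A'\<in>\<A>. \<Sum>k\<in>K. c (T0 A') k *\<^sub>R indicator (atom A') x *\<^sub>R b k x)"
        using elim by simp
      also have "\<dots> = (\<Sum>A'\<in>\<A>. if A' = A then \<Sum>k\<in>K. c (T0 A') k *\<^sub>R b k x else 0)"
        by (intro sum.cong) (auto simp: ind)
      also have "\<dots> = (if A \<in> \<A> then \<Sum>k\<in>K. c (T0 A) k *\<^sub>R b k x else 0)"
        using finA by simp
      also have "\<dots> = rep_L2 u x"
      proof (cases "A \<in> \<A>")
        case True
        then have "x \<in> T0 A" "T0 A \<in> \<T>" using T0[OF True] by (auto simp: A_def)
        with True elim(1) show ?thesis by simp
      next
        case False
        then have "A = {}" by (auto simp: A_def \<A>_def)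
        then have "x \<notin> \<Union>\<T>" by (auto simp: A_def)
        then show ?thesis using elim False by simp
      qed
      finally show ?case by simp
    qed
    then have "u = v" by (rule L2_eqI)
    also have "v \<in> span B"
      unfolding v_def B_def by (intro span_sum span_scale span_base) auto
    finally show ?thesis .
  qed
  moreover have "finite B" using finA K by (simp add: B_def)
  ultimately show ?thesis by blast
qed

lemma AE_piecewise_subspace:
  assumes F: "(\<lambda>x. 0) \<in> F" "\<And>p q. p \<in> F \<Longrightarrow> q \<in> F \<Longrightarrow> (\<lambda>x. p x + q x) \<in> F"
    "\<And>p c. p \<in> F \<Longrightarrow> (\<lambda>x. c *\<^sub>R p x) \<in> F" and W: "subspace W"
  shows "subspace {u \<in> W. \<forall>T\<in>\<T>. \<exists>p\<in>F. AE x in lebesgue. x \<in> T \<longrightarrow> rep_L2 u x = p x}"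
  unfolding subspace_def
proof (intro conjI ballI allI)
  show "0 \<in> {u \<in> W. \<forall>T\<in>\<T>. \<exists>p\<in>F. AE x in lebesgue. x \<in> T \<longrightarrow> rep_L2 u x = p x}"
    using subspace_0[OF W] F(1) rep_L2_zero by (auto intro!: bexI[of _ "\<lambda>x. 0"] elim: AE_mp)
next
  fix u v assume u: "u \<in> {u \<in> W. \<forall>T\<in>\<T>. \<exists>p\<in>F. AE x in lebesgue. x \<in> T \<longrightarrow> rep_L2 u x = p x}"
    and v: "v \<in> {u \<in> W. \<forall>T\<in>\<T>. \<exists>p\<in>F. AE x in lebesgue. x \<in> T \<longrightarrow> rep_L2 u x = p x}"
  have "\<exists>p\<in>F. AE x in lebesgue. x \<in> T \<longrightarrow> rep_L2 (u + v) x = p x" if "T \<in> \<T>" for T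
  proof -
    from u v that obtain p q where pq: "p \<in> F" "q \<in> F"
      "AE x in lebesgue. x \<in> T \<longrightarrow> rep_L2 u x = p x" "AE x in lebesgue. x \<in> T \<longrightarrow> rep_L2 v x = q x"
      by blast
    from pq(3,4) rep_L2_add[of u v] have "AE x in lebesgue. x \<in> T \<longrightarrow> rep_L2 (u + v) x = p x + q x"
      by eventually_elim simp
    then show ?thesis using F(2)[OF pq(1,2)] by (intro bexI[of _ "\<lambda>x. p x + q x"])
  qed
  then show "u + v \<in> {u \<in> W. \<forall>T\<in>\<T>. \<exists>p\<in>F. AE x in lebesgue. x \<in> T \<longrightarrow> rep_L2 u x = p x}"
    using u v subspace_add[OF W] by simp
next
  fix c u assume u: "u \<in> {u \<in> W. \<forall>T\<in>\<T>. \<exists>p\<in>F. AE x in lebesgue. x \<in> T \<longrightarrow> rep_L2 u x = p x}"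
  have "\<exists>p\<in>F. AE x in lebesgue. x \<in> T \<longrightarrow> rep_L2 (c *\<^sub>R u) x = p x" if "T \<in> \<T>" for T
  proof -
    from u that obtain p where pq: "p \<in> F" "AE x in lebesgue. x \<in> T \<longrightarrow> rep_L2 u x = p x"
      by blast
    from pq(2) rep_L2_scaleR[of c u] have "AE x in lebesgue. x \<in> T \<longrightarrow> rep_L2 (c *\<^sub>R u) x = c *\<^sub>R p x"
      by eventually_elim simp
    then show ?thesis using F(3)[OF pq(1), of c] by (intro bexI[of _ "\<lambda>x. c *\<^sub>R p x"])
  qed
  then show "c *\<^sub>R u \<in> {u \<in> W. \<forall>T\<in>\<T>. \<exists>p\<in>F. AE x in lebesgue. x \<in> T \<longrightarrow> rep_L2 u x = p x}"
    using u subspace_scale[OF W] by simp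
qed

lemma L2_on_outside_mesh:
  assumes "triangulates \<T> \<Omega>" "u \<in> L2_on \<Omega>"
  shows "AE x in lebesgue. x \<notin> \<Union>\<T> \<longrightarrow> rep_L2 u x = 0"
proof -
  have "AE x in lebesgue. x \<notin> \<Omega> \<longrightarrow> rep_L2 u x = 0" using assms(2) by (simp add: L2_on_def)
  then show ?thesis
    by eventually_elim (use triangulatesD(4)[OF assms(1)] closure_subset in blast)
qed

lemma S_space_finite_dim:
  fixes \<Omega> :: "(real^'n) set"
  assumes "triangulates \<T> \<Omega>"
  shows "finite_dim_subspace (S_space \<Omega> \<T> r)"
  unfolding finite_dim_subspace_def
proof
  show "subspace (S_space \<Omega> \<T> r)"
    unfolding S_space_def
    by (rule AE_piecewise_subspace[OF poly_fun_zero poly_fun_add _ subspace_L2_on])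
      (auto intro: poly_fun_cmult)
  show "\<exists>B. finite B \<and> S_space \<Omega> \<T> r \<subseteq> span B"
  proof (rule piecewise_finite_dimensional[where F = "poly_fun r" and b = monomial and K = "multi_indices r"])
    show "\<exists>c. p = (\<lambda>x. \<Sum>k\<in>multi_indices r. c k *\<^sub>R monomial k x)" if "p \<in> poly_fun r" for p :: "real^'n \<Rightarrow> real"
      using that by (simp add: poly_fun_eq)
    show "AE x in lebesgue. x \<notin> \<Union>\<T> \<longrightarrow> rep_L2 u x = 0" if "u \<in> S_space \<Omega> \<T> r" for u
      using that by (intro L2_on_outside_mesh[OF assms]) (simp add: S_space_def)
  qed (use triangulatesD[OF assms] finite_multi_indices monomial_continuous in \<open>auto simp: S_space_def\<close>)
qed

lemma RT_fun_add:
  assumes "f \<in> RT_fun r" "g \<in> RT_fun r" shows "(\<lambda>x. f x + g x) \<in> RT_fun r"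
proof -
  from assms obtain p q p' q' where "f = (\<lambda>x. p x + q x *\<^sub>R x)" "\<And>i. (\<lambda>x. p x $ i) \<in> poly_fun r" "q \<in> poly_fun r"
    "g = (\<lambda>x. p' x + q' x *\<^sub>R x)" "\<And>i. (\<lambda>x. p' x $ i) \<in> poly_fun r" "q' \<in> poly_fun r"
    unfolding RT_fun_def by blast
  then show ?thesis unfolding RT_fun_def mem_Collect_eq
    by (intro exI[of _ "\<lambda>x. p x + p' x"] exI[of _ "\<lambda>x. q x + q' x"])
      (auto simp: algebra_simps intro: poly_fun_add)
qed

lemma RT_fun_scaleR:
  assumes "f \<in> RT_fun r" shows "(\<lambda>x. c *\<^sub>R f x) \<in> RT_fun r"
proof -
  from assms obtain p q where "f = (\<lambda>x. p x + q x *\<^sub>R x)" "\<And>i. (\<lambda>x. p x $ i) \<in> poly_fun r" "q \<in> poly_fun r"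
    unfolding RT_fun_def by blast
  then show ?thesis unfolding RT_fun_def mem_Collect_eq
    by (intro exI[of _ "\<lambda>x. c *\<^sub>R p x"] exI[of _ "\<lambda>x. c * q x"])
      (auto simp: scaleR_add_right intro: poly_fun_cmult)
qed

lemma RT_fun_zero: "(\<lambda>x. 0) \<in> RT_fun r"
  unfolding RT_fun_def mem_Collect_eq
  by (intro exI[of _ "\<lambda>x. 0"]) (auto simp: poly_fun_zero)

text \<open>A family that spans the Raviart--Thomas fields: a monomial times a unit vector \<open>axis i 1\<close>,
  or times the position vector \<open>x\<close> if the second index is \<open>None\<close>.\<close>

definition RT_basis :: "('n::finite \<Rightarrow> nat) \<times> 'n option \<Rightarrow> real^'n \<Rightarrow> real^'n" where
  "RT_basis k x = monomial (fst k) x *\<^sub>R (case snd k of None \<Rightarrow> x | Some i \<Rightarrow> axis i 1)"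

lemma RT_fun_expansion:
  fixes f :: "real^'n \<Rightarrow> real^'n"
  assumes "f \<in> RT_fun r"
  shows "\<exists>c. f = (\<lambda>x. \<Sum>k\<in>multi_indices r \<times> UNIV. c k *\<^sub>R RT_basis k x)"
proof -
  from assms obtain p q where f: "f = (\<lambda>x. p x + q x *\<^sub>R x)" and p: "\<And>i. (\<lambda>x. p x $ i) \<in> poly_fun r"
    and q: "q \<in> poly_fun r"
    by (auto simp: RT_fun_def)
  from q obtain d where d: "q = (\<lambda>x. \<Sum>\<alpha>\<in>multi_indices r. d \<alpha> * monomial \<alpha> x)"
    by (auto simp: poly_fun_eq)
  have "\<forall>i. \<exists>c. (\<lambda>x. p x $ i) = (\<lambda>x. \<Sum>\<alpha>\<in>multi_indices r. c \<alpha> * monomial \<alpha> x)"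
    using p by (auto simp: poly_fun_eq)
  then obtain c where c: "\<And>i. (\<lambda>x. p x $ i) = (\<lambda>x. \<Sum>\<alpha>\<in>multi_indices r. c i \<alpha> * monomial \<alpha> x)"
    by metis
  define C where "C = (\<lambda>(\<alpha>, j). case j of None \<Rightarrow> d \<alpha> | Some i \<Rightarrow> c i \<alpha>)"
  have "f x = (\<Sum>k\<in>multi_indices r \<times> UNIV. C k *\<^sub>R RT_basis k x)" for x
  proof -
    have opt: "(\<Sum>j\<in>UNIV. g j) = g None + (\<Sum>i\<in>UNIV. g (Some i))" for g :: "'n option \<Rightarrow> real^'n"
      by (simp add: UNIV_option_conv sum.reindex)
    have "p x = (\<Sum>i\<in>UNIV. p x $ i *\<^sub>R axis i 1)"
      by (simp add: vec_eq_iff axis_def if_distrib[of "\<lambda>a. _ * a"] cong: if_cong)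
    also have "\<dots> = (\<Sum>i\<in>UNIV. \<Sum>\<alpha>\<in>multi_indices r. (c i \<alpha> * monomial \<alpha> x) *\<^sub>R axis i 1)"
      using c[THEN fun_cong, of x] by (simp add: scaleR_sum_left)
    also have "\<dots> = (\<Sum>\<alpha>\<in>multi_indices r. \<Sum>i\<in>UNIV. (c i \<alpha> * monomial \<alpha> x) *\<^sub>R axis i 1)"
      by (rule sum.swap)
    finally have "p x = \<dots>" .
    moreover have "q x *\<^sub>R x = (\<Sum>\<alpha>\<in>multi_indices r. (d \<alpha> * monomial \<alpha> x) *\<^sub>R x)"
      by (simp add: d scaleR_sum_left)
    ultimately show ?thesis
      by (simp add: f sum.cartesian_product' opt C_def RT_basis_def sum.distrib)
  qed
  then show ?thesis by blast
qed

lemma V_space_finite_dim: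
  fixes \<Omega> :: "(real^'n) set"
  assumes "triangulates \<T> \<Omega>"
  shows "finite_dim_subspace (V_space \<Omega> \<T> r)"
  unfolding finite_dim_subspace_def
proof
  show "subspace (V_space \<Omega> \<T> r)"
    unfolding V_space_def
    by (rule AE_piecewise_subspace[OF RT_fun_zero RT_fun_add RT_fun_scaleR subspace_Hdiv])
  show "\<exists>B. finite B \<and> V_space \<Omega> \<T> r \<subseteq> span B"
  proof (rule piecewise_finite_dimensional[where F = "RT_fun r" and b = RT_basis and K = "multi_indices r \<times> UNIV"])
    show "continuous_on UNIV (RT_basis k)" for k :: "('n \<Rightarrow> nat) \<times> 'n option"
      unfolding RT_basis_def[abs_def]
      by (cases "snd k") (auto intro!: continuous_intros monomial_continuous)
    show "AE x in lebesgue. x \<notin> \<Union>\<T> \<longrightarrow> rep_L2 u x = 0" if "u \<in> V_space \<Omega> \<T> r" for u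
      using that by (intro L2_on_outside_mesh[OF assms]) (simp add: V_space_def Hdiv_def)
    show "finite (multi_indices r \<times> (UNIV :: 'n option set))"
      by (intro finite_cartesian_product finite_multi_indices) simp
  qed (use triangulatesD[OF assms] finite_multi_indices RT_fun_expansion in \<open>auto simp: V_space_def\<close>)
qed

text \<open>The boundary of an open set has empty interior, so the polytopes that form it do too, and a
  convex set with empty interior is contained in its own boundary, which is null.\<close>

lemma bounded_polygonal_domainD:
  assumes "bounded_polygonal_domain \<Omega>"
  shows "open \<Omega>" "negligible (frontier \<Omega>)"
proof -
  show o: "open \<Omega>" using assms by (simp add: bounded_polygonal_domain_def)
  obtain \<P> where P: "finite \<P>" "\<And>P. P \<in> \<P> \<Longrightarrow> polytope P" "frontier \<Omega> = \<Union>\<P>"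
    using assms by (auto simp: bounded_polygonal_domain_def)
  have "interior (frontier \<Omega>) = {}"
  proof -
    have "interior (frontier \<Omega>) \<inter> \<Omega> = {}"
      using o interior_subset[of "frontier \<Omega>"] by (auto simp: frontier_def interior_open)
    then have "interior (frontier \<Omega>) \<inter> closure \<Omega> = {}"
      using open_Int_closure_eq_empty[OF open_interior] by blast
    moreover have "interior (frontier \<Omega>) \<subseteq> closure \<Omega>"
      using interior_subset[of "frontier \<Omega>"] by (auto simp: frontier_def)
    ultimately show ?thesis by blast
  qed
  then have "negligible P" if "P \<in> \<P>" for P
  proof -
    have "interior P \<subseteq> interior (frontier \<Omega>)" using P(3) that by (intro interior_mono) auto
    then have "interior P = {}" using \<open>interior (frontier \<Omega>) = {}\<close> by auto
    then have "P \<subseteq> frontier P" using closure_subset by (auto simp: frontier_def)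
    moreover have "negligible (frontier P)"
      using P(2)[OF that] by (intro negligible_convex_frontier polytope_imp_convex)
    ultimately show ?thesis using negligible_subset by blast
  qed
  then show "negligible (frontier \<Omega>)"
    unfolding P(3) using P(1) by (intro negligible_Union) auto
qed

text \<open>On the interior of a simplex \<open>T\<close> within \<open>\<Omega>\<close>, the weak divergence is the classical one by
  integration by parts. The rest of \<open>T\<close> lies in the boundary of \<open>T\<close> or, as \<open>T\<close> is contained in the
  closure of \<open>\<Omega>\<close>, in that of \<open>\<Omega>\<close>, and is therefore null.\<close>

lemma weak_div_V_space_in_S_space:
  fixes \<Omega> :: "(real^'n) set"
  assumes \<Omega>: "bounded_polygonal_domain \<Omega>" and \<T>: "triangulates \<T> \<Omega>" and \<sigma>: "\<sigma> \<in> V_space \<Omega> \<T> r"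
  shows "weak_div \<Omega> \<sigma> \<in> S_space \<Omega> \<T> r"
proof -
  note D = bounded_polygonal_domainD[OF \<Omega>] and TD = triangulatesD[OF \<T>]
  have H: "\<sigma> \<in> Hdiv \<Omega>" using \<sigma> by (simp add: V_space_def)
  define g where "g = weak_div \<Omega> \<sigma>"
  have g: "g \<in> L2_on \<Omega>" "has_weak_div \<Omega> \<sigma> g"
    unfolding g_def using weak_divD[OF D(1) H] .
  have "\<exists>d\<in>poly_fun r. AE x in lebesgue. x \<in> T \<longrightarrow> rep_L2 g x = d x" if T: "T \<in> \<T>" for T
  proof -
    from \<sigma> T obtain p where p: "p \<in> RT_fun r" "AE x in lebesgue. x \<in> T \<longrightarrow> rep_L2 \<sigma> x = p x"
      by (auto simp: V_space_def)
    obtain P where P: "\<And>i. C1_gradient (\<lambda>x. p x $ i) (P i)" "(\<lambda>x. \<Sum>i\<in>UNIV. P i x $ i) \<in> poly_fun r"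
      by (rule RT_fun_divergence[OF p(1)]) (rule that)
    define d where "d = (\<lambda>x. \<Sum>i\<in>UNIV. P i x $ i)"
    have dc: "continuous_on UNIV d" using poly_fun_continuous P(2) by (simp add: d_def)
    have pc: "continuous_on UNIV p"
      by (rule continuous_on_C1_components[OF P(1)])
    have "AE x in lebesgue. x \<in> interior T \<inter> \<Omega> \<longrightarrow> rep_L2 g x - d x = 0"
    proof (rule fundamental_lemma)
      show "locally_integrable (\<lambda>x. rep_L2 g x - d x)"
        by (intro locally_integrable_diff locally_integrable_rep_L2 locally_integrable_continuous dc)
      show "open (interior T \<inter> \<Omega>)" using D(1) by auto
      fix \<phi> \<phi>' assume t: "test_function (interior T \<inter> \<Omega>) \<phi> \<phi>'"
      then have t\<Omega>: "test_function \<Omega> \<phi> \<phi>'" by (auto simp: test_function_def)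
      have C: "compact (closure {x. \<phi> x \<noteq> 0})" and gr: "C1_gradient \<phi> \<phi>'"
        using t by (auto simp: test_function_def C1_gradient_def)
      have out: "\<phi> x = 0" "\<phi>' x = 0" if "x \<notin> closure {x. \<phi> x \<noteq> 0}" for x
        using that test_function_gradient_zero[OF t] closure_subset[of "{x. \<phi> x \<noteq> 0}"] by auto
      have outT: "\<phi>' x = 0" if "x \<notin> T" for x
        using that t interior_subset[of T] by (intro out(2)) (auto simp: test_function_def)
      have i1: "integrable lebesgue (\<lambda>x. p x \<bullet> \<phi>' x)"
        by (rule continuous_compact_support_integrable[OF continuous_on_inner C, OF pc C1_gradient_continuous'[OF gr]])
          (drule out(2), simp)
      have i2: "integrable lebesgue (\<lambda>x. d x * \<phi> x)"
        by (rule continuous_compact_support_integrable[OF continuous_on_mult C, OF dc C1_gradient_continuous[OF gr]])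
          (drule out(1), simp)
      have "AE x in lebesgue. rep_L2 \<sigma> x \<bullet> \<phi>' x = p x \<bullet> \<phi>' x"
        using p(2) by eventually_elim (use outT in force)
      then have "(LINT x|lebesgue. rep_L2 \<sigma> x \<bullet> \<phi>' x) = (LINT x|lebesgue. p x \<bullet> \<phi>' x)"
        by (rule integral_cong_AE_L2) (intro i1 test_function_integrable[OF t\<Omega>])+
      also have "\<dots> = - (LINT x|lebesgue. d x * \<phi> x)"
        unfolding d_def by (rule integration_by_parts[OF P(1) t])
      finally have "(LINT x|lebesgue. rep_L2 g x * \<phi> x) = (LINT x|lebesgue. d x * \<phi> x)"
        using g(2) t\<Omega> by (simp add: has_weak_div_def)
      then show "(LINT x|lebesgue. (rep_L2 g x - d x) * \<phi> x) = 0"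
        using i2 test_function_integrable(1)[OF t\<Omega>, of g] by (simp add: left_diff_distrib)
    qed
    moreover have "AE x in lebesgue. x \<notin> frontier T"
      using negligible_convex_frontier[OF TD(3)[OF T]]
      by (intro AE_not_in) (simp add: negligible_iff_null_sets)
    moreover have "AE x in lebesgue. x \<notin> frontier \<Omega>"
      using D(2) by (intro AE_not_in) (simp add: negligible_iff_null_sets)
    ultimately have "AE x in lebesgue. x \<in> T \<longrightarrow> rep_L2 g x = d x"
    proof eventually_elim
      case (elim x)
      show ?case
      proof
        assume x: "x \<in> T"
        then have "x \<in> interior T" using elim(2) closure_subset[of T] by (auto simp: frontier_def)
        moreover have "x \<in> closure \<Omega>" using x T TD(4) by auto
        then have "x \<in> \<Omega>" using elim(3) D(1) by (auto simp: frontier_def interior_open)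
        ultimately show "rep_L2 g x = d x" using elim(1) by simp
      qed
    qed
    moreover have "d \<in> poly_fun r" using P(2) by (simp add: d_def)
    ultimately show ?thesis by (rule bexI)
  qed
  then show ?thesis using g(1) unfolding g_def[symmetric] by (simp add: S_space_def)
qed

theorem theorem3p2:
  fixes \<Omega> :: "(real^'n) set"
    and H :: "real set"
    and \<T> :: "real \<Rightarrow> (real^'n) set set"
    and r :: nat
    and \<beta> s h :: real
    and u :: "(real^'n, real) L2"
  assumes "bounded_polygonal_domain \<Omega>"
    and "\<And>h. h \<in> H \<Longrightarrow> triangulates (\<T> h) \<Omega>"
    and "shape_regular (\<T> ` H)"
    and "\<beta> > 0"
    and "\<And>h u. h \<in> H \<Longrightarrow> u \<in> S_space \<Omega> (\<T> h) r \<Longrightarrow>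
           (SUP \<tau> \<in> V_space \<Omega> (\<T> h) r - {0}.
              (u \<bullet> weak_div \<Omega> \<tau>) / (Lambda_op \<Omega> (\<T> h) r \<tau> \<bullet> \<tau>) powr (1/2)) \<ge> \<beta> * norm u"
    and "0 \<le> s" and "s \<le> 1"
    and "h \<in> H"
    and "u \<in> S_space \<Omega> (\<T> h) r"
  shows "\<beta> powr (2 * (1 - s)) *
           (frac_power (S_space \<Omega> (\<T> h) r) (discrete_laplacian \<Omega> (\<T> h) r) s u \<bullet> u)
         \<le> frac_power (V_space \<Omega> (\<T> h) r) (Lambda_op \<Omega> (\<T> h) r) (- (1 - s))
             (discrete_grad \<Omega> (\<T> h) r u) \<bullet> discrete_grad \<Omega> (\<T> h) r u \<and>
         frac_power (V_space \<Omega> (\<T> h) r) (Lambda_op \<Omega> (\<T> h) r) (- (1 - s))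
             (discrete_grad \<Omega> (\<T> h) r u) \<bullet> discrete_grad \<Omega> (\<T> h) r u
         \<le> frac_power (S_space \<Omega> (\<T> h) r) (discrete_laplacian \<Omega> (\<T> h) r) s u \<bullet> u"
proof -
  let ?S = "S_space \<Omega> (\<T> h) r" and ?V = "V_space \<Omega> (\<T> h) r"
  note tri = assms(2)[OF \<open>h \<in> H\<close>]
  have ops: "discrete_grad \<Omega> (\<T> h) r = (\<lambda>u. riesz ?V (\<lambda>\<tau>. - (u \<bullet> weak_div \<Omega> \<tau>)))"
    "Lambda_op \<Omega> (\<T> h) r = (\<lambda>\<sigma>. riesz ?V (\<lambda>\<tau>. \<sigma> \<bullet> \<tau> + weak_div \<Omega> \<sigma> \<bullet> weak_div \<Omega> \<tau>))"
    "discrete_laplacian \<Omega> (\<T> h) r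
       = (\<lambda>u. riesz ?S (\<lambda>v. discrete_grad \<Omega> (\<T> h) r u \<bullet> discrete_grad \<Omega> (\<T> h) r v))"
    by (simp_all add: fun_eq_iff discrete_grad_def Lambda_op_def discrete_laplacian_def)
  have lin: "linear_on_subspace ?V (weak_div \<Omega>)"
    by (rule weak_div_linear[OF bounded_polygonal_domainD(1)[OF assms(1)]]) (auto simp: V_space_def)
  have into: "weak_div \<Omega> \<tau> \<in> ?S" if "\<tau> \<in> ?V" for \<tau>
    using weak_div_V_space_in_S_space[OF assms(1) tri that] .
  note main = inf_sup_fractional_bounds[OF S_space_finite_dim[OF tri] V_space_finite_dim[OF tri] lin into
      assms(6,7,4) assms(5)[OF \<open>h \<in> H\<close>, unfolded ops] assms(9)]
  show ?thesis
    unfolding ops by (intro conjI main)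
qed

end
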